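(* Let $n=2^e\ge 4$ and $k,l\in\{0,1\}$, with $k=l=0$ if $e=2$, and let $a,b$ be the defining generators of $G_2(e;k,l)$. The automorphisms of $G_2(e;k,l)$ are exactly the maps given by $\sigma\colon a\mapsto a^ib^j,\ b\mapsto a^fb^h$, where $i,j,f,h$ are integers such that (i) either $i$ and $h$ are odd and $j$ and $f$ are even, or $i$ and $h$ are even and $j$ and $f$ are odd, and (ii) $i+j\equiv f+h\pmod 4$ if $l=1$.
   Context: Conventions: $x^y=y^{-1}xy$ and $[x,y]=x^{-1}y^{-1}xy$. For $n=2^e\ge 4$ and $k,l\in\{0,1\}$ (with $k=l=0$ when $n=4$), $$G_2(e;k,l)=\langle a,b\mid a^n=b^n=[b^2,a^2]=1,\ [b,a]=a^2b^{-2}(a^{n/2}b^{n/2})^k,\ (b^2)^a=b^{-2}(a^{n/2}b^{n/2})^l,\ (a^2)^b=a^{-2}(a^{n/2}b^{n/2})^l\rangle .$$ *)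

theory Defs
  imports "HOL-Algebra.Algebra" "HOL-Number_Theory.Cong"
begin

section \<open>Groups given by generators and relations\<close>

text \<open>
  The library has no free groups, so the group
  \<open>\<langle>X | u\<^sub>i = v\<^sub>i\<rangle>\<close> (with \<open>X\<close> all of the type \<open>'x\<close>) is built
  directly as the monoid of words in the letters \<open>x\<close>, \<open>x\<inverse>\<close> modulo the least congruence
  that contains free cancellation and the pairs \<open>(u\<^sub>i, v\<^sub>i)\<close>.
  The letter \<open>(x, True)\<close> stands for \<open>x\<close>, and \<open>(x, False)\<close> for \<open>x\<inverse>\<close>.
\<close>

type_synonym 'x word = "('x \<times> bool) list"

definition gen_word :: "'x \<Rightarrow> 'x word" where
  "gen_word x = [(x, True)]"

definition inv_word :: "'x word \<Rightarrow> 'x word" where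
  "inv_word w = rev (map (\<lambda>(x, s). (x, \<not> s)) w)"

definition pow_word :: "'x word \<Rightarrow> nat \<Rightarrow> 'x word" where
  "pow_word w m = concat (replicate m w)"

text \<open>The conventions are \<open>x\<^sup>y = y\<inverse> x y\<close> and \<open>[x, y] = x\<inverse> y\<inverse> x y\<close>.\<close>

definition conj_word :: "'x word \<Rightarrow> 'x word \<Rightarrow> 'x word" where
  "conj_word x y = inv_word y @ x @ y"

definition comm_word :: "'x word \<Rightarrow> 'x word \<Rightarrow> 'x word" where
  "comm_word x y = inv_word x @ inv_word y @ x @ y"

inductive word_equiv :: "('x word \<times> 'x word) set \<Rightarrow> 'x word \<Rightarrow> 'x word \<Rightarrow> bool"
  for R :: "('x word \<times> 'x word) set"
where
  refl: "word_equiv R u u"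
| sym: "word_equiv R u v \<Longrightarrow> word_equiv R v u"
| trans: "word_equiv R u v \<Longrightarrow> word_equiv R v w \<Longrightarrow> word_equiv R u w"
| mult: "word_equiv R u u' \<Longrightarrow> word_equiv R v v' \<Longrightarrow> word_equiv R (u @ v) (u' @ v')"
| cancel: "word_equiv R [(x, s), (x, \<not> s)] []"
| rel: "(u, v) \<in> R \<Longrightarrow> word_equiv R u v"

definition word_class :: "('x word \<times> 'x word) set \<Rightarrow> 'x word \<Rightarrow> 'x word set" where
  "word_class R u = {v. word_equiv R u v}"

definition presented_group :: "('x word \<times> 'x word) set \<Rightarrow> 'x word set monoid" where
  "presented_group R =
     \<lparr>carrier = range (word_class R),
      monoid.mult = (\<lambda>U V. \<Union>u\<in>U. \<Union>v\<in>V. word_class R (u @ v)),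
      one = word_class R []\<rparr>"

abbreviation pres_gen :: "('x word \<times> 'x word) set \<Rightarrow> 'x \<Rightarrow> 'x word set" where
  "pres_gen R x \<equiv> word_class R (gen_word x)"

lemma word_class_eq_iff: "word_class R u = word_class R v \<longleftrightarrow> word_equiv R u v"
  unfolding word_class_def by (blast intro: word_equiv.refl word_equiv.sym word_equiv.trans)

lemma presented_group_carrier: "carrier (presented_group R) = range (word_class R)"
  by (simp add: presented_group_def)

lemma word_class_in_carrier: "word_class R u \<in> carrier (presented_group R)"
  by (simp add: presented_group_def)

lemma presented_group_one: "\<one>\<^bsub>presented_group R\<^esub> = word_class R []"
  by (simp add: presented_group_def)

lemma presented_group_mult:
  "word_class R u \<otimes>\<^bsub>presented_group R\<^esub> word_class R v = word_class R (u @ v)"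
proof -
  have "word_class R (u' @ v') = word_class R (u @ v)"
    if "u' \<in> word_class R u" and "v' \<in> word_class R v" for u' v'
  proof -
    have "word_equiv R u' u" "word_equiv R v' v"
      using that unfolding word_class_def mem_Collect_eq by - (erule word_equiv.sym)+
    then show ?thesis
      unfolding word_class_eq_iff by (rule word_equiv.mult)
  qed
  moreover have "u \<in> word_class R u" "v \<in> word_class R v"
    by (auto simp: word_class_def intro: word_equiv.refl)
  ultimately have "(\<Union>u'\<in>word_class R u. \<Union>v'\<in>word_class R v. word_class R (u' @ v')) =
      word_class R (u @ v)"
    by blast
  then show ?thesis
    by (simp add: presented_group_def)
qed

lemma word_equiv_inv_left: "word_equiv R (inv_word u @ u) []"
proof (induction u)
  case Nil
  show ?case by (simp add: inv_word_def word_equiv.refl)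
next
  case (Cons p u)
  obtain x s where p: "p = (x, s)" by force
  have "word_equiv R [(x, \<not> s), (x, s)] []"
    using word_equiv.cancel[of R x "\<not> s"] by simp
  then have "word_equiv R (inv_word u @ [(x, \<not> s), (x, s)] @ u) (inv_word u @ [] @ u)"
    by (intro word_equiv.mult word_equiv.refl)
  then have "word_equiv R (inv_word (p # u) @ p # u) (inv_word u @ u)"
    by (simp add: inv_word_def p)
  then show ?case
    using Cons.IH by (rule word_equiv.trans)
qed

lemma group_presented_group: "group (presented_group R)"
proof (rule groupI)
  show "U \<otimes>\<^bsub>presented_group R\<^esub> V \<in> carrier (presented_group R)"
    if "U \<in> carrier (presented_group R)" "V \<in> carrier (presented_group R)" for U V
    using that unfolding presented_group_carrier by (elim imageE) (simp add: presented_group_mult)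
  show "\<one>\<^bsub>presented_group R\<^esub> \<in> carrier (presented_group R)"
    by (simp add: presented_group_carrier presented_group_one)
  show "U \<otimes>\<^bsub>presented_group R\<^esub> V \<otimes>\<^bsub>presented_group R\<^esub> W =
      U \<otimes>\<^bsub>presented_group R\<^esub> (V \<otimes>\<^bsub>presented_group R\<^esub> W)"
    if "U \<in> carrier (presented_group R)" "V \<in> carrier (presented_group R)"
      "W \<in> carrier (presented_group R)" for U V W
    using that unfolding presented_group_carrier by (elim imageE) (simp add: presented_group_mult)
  show "\<one>\<^bsub>presented_group R\<^esub> \<otimes>\<^bsub>presented_group R\<^esub> U = U"
    if "U \<in> carrier (presented_group R)" for U
    using that unfolding presented_group_carrier
    by (elim imageE) (simp add: presented_group_mult presented_group_one)
next
  fix U assume "U \<in> carrier (presented_group R)"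
  then obtain u where U: "U = word_class R u"
    by (auto simp: presented_group_carrier)
  show "\<exists>V\<in>carrier (presented_group R). V \<otimes>\<^bsub>presented_group R\<^esub> U = \<one>\<^bsub>presented_group R\<^esub>"
    by (rule bexI[of _ "word_class R (inv_word u)"])
      (simp_all add: U word_class_in_carrier presented_group_mult presented_group_one
        word_class_eq_iff word_equiv_inv_left)
qed

lemma presented_group_inv: "inv\<^bsub>presented_group R\<^esub> word_class R u = word_class R (inv_word u)"
  by (rule group.inv_equality[OF group_presented_group])
    (simp_all add: word_class_in_carrier presented_group_mult presented_group_one
      word_class_eq_iff word_equiv_inv_left)

lemma presented_group_rel:
  "(u, v) \<in> R \<Longrightarrow> word_class R u = word_class R v"
  by (simp add: word_class_eq_iff word_equiv.rel)

text \<open>Evaluation of words in a group, and the universal property (von Dyck).\<close>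

fun word_eval :: "('a, 'm) monoid_scheme \<Rightarrow> ('x \<Rightarrow> 'a) \<Rightarrow> 'x word \<Rightarrow> 'a" where
  "word_eval H f [] = \<one>\<^bsub>H\<^esub>"
| "word_eval H f ((x, s) # w) = (if s then f x else inv\<^bsub>H\<^esub> f x) \<otimes>\<^bsub>H\<^esub> word_eval H f w"

lemma word_eval_closed:
  assumes "group H" "range f \<subseteq> carrier H"
  shows "word_eval H f w \<in> carrier H"
proof -
  interpret group H by fact
  have f: "f x \<in> carrier H" for x using assms(2) by auto
  show ?thesis by (induction w) (auto simp: f)
qed

lemma word_eval_append:
  assumes "group H" "range f \<subseteq> carrier H"
  shows "word_eval H f (u @ v) = word_eval H f u \<otimes>\<^bsub>H\<^esub> word_eval H f v"
proof -
  interpret group H by fact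
  have f: "f x \<in> carrier H" for x using assms(2) by auto
  note c = word_eval_closed[OF assms]
  show ?thesis by (induction u) (auto simp: c f m_assoc)
qed

lemma word_eval_equiv:
  assumes "group H" "range f \<subseteq> carrier H"
    and "\<And>u v. (u, v) \<in> R \<Longrightarrow> word_eval H f u = word_eval H f v"
    and "word_equiv R u v"
  shows "word_eval H f u = word_eval H f v"
proof -
  interpret group H by fact
  have f: "f x \<in> carrier H" for x using assms(2) by auto
  show ?thesis using assms(4)
  proof induction
    case (rel u v)
    then show ?case by (rule assms(3))
  qed (simp_all add: word_eval_append[OF assms(1,2)] f)
qed

lemma presented_group_universal:
  assumes "group H" "range f \<subseteq> carrier H"
    and "\<And>u v. (u, v) \<in> R \<Longrightarrow> word_eval H f u = word_eval H f v"
  shows "\<exists>\<phi>\<in>hom (presented_group R) H. \<forall>x. \<phi> (pres_gen R x) = f x"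
proof -
  interpret group H by fact
  have f: "f x \<in> carrier H" for x using assms(2) by auto
  define \<phi> where "\<phi> U = word_eval H f (SOME u. U = word_class R u)" for U
  have \<phi>: "\<phi> (word_class R u) = word_eval H f u" for u
  proof -
    have "word_class R u = word_class R (SOME u'. word_class R u = word_class R u')"
      by (rule someI[where P = "\<lambda>u'. word_class R u = word_class R u'"]) (rule HOL.refl)
    then have "word_equiv R u (SOME u'. word_class R u = word_class R u')"
      by (rule word_class_eq_iff[THEN iffD1])
    then have "word_eval H f u = word_eval H f (SOME u'. word_class R u = word_class R u')"
      by (rule word_eval_equiv[OF assms(1,2), rotated]) (rule assms(3))
    then show ?thesis
      unfolding \<phi>_def by (rule HOL.sym)
  qed
  have "\<phi> \<in> hom (presented_group R) H"
  proof (rule homI)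
    fix U assume "U \<in> carrier (presented_group R)"
    then show "\<phi> U \<in> carrier H"
      unfolding presented_group_carrier
      by (elim imageE) (simp add: \<phi> word_eval_closed[OF assms(1,2)])
  next
    fix U V assume "U \<in> carrier (presented_group R)" "V \<in> carrier (presented_group R)"
    then show "\<phi> (U \<otimes>\<^bsub>presented_group R\<^esub> V) = \<phi> U \<otimes>\<^bsub>H\<^esub> \<phi> V"
      unfolding presented_group_carrier
      by (elim imageE) (simp add: presented_group_mult \<phi> word_eval_append[OF assms(1,2)])
  qed
  moreover have "\<phi> (pres_gen R x) = f x" for x
    by (simp add: \<phi> gen_word_def f)
  ultimately show ?thesis by blast
qed


section \<open>The groups \<open>G\<^sub>2(e;k,l)\<close>\<close>

datatype gen = Gen_a | Gen_b

definition G2_rels :: "nat \<Rightarrow> nat \<Rightarrow> nat \<Rightarrow> (gen word \<times> gen word) set" where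
  "G2_rels e k l =
    (let n = 2 ^ e;
         a = gen_word Gen_a;
         b = gen_word Gen_b;
         z = pow_word a (n div 2) @ pow_word b (n div 2)
     in {(pow_word a n, []),
         (pow_word b n, []),
         (comm_word (pow_word b 2) (pow_word a 2), []),
         (comm_word b a, pow_word a 2 @ inv_word (pow_word b 2) @ pow_word z k),
         (conj_word (pow_word b 2) a, inv_word (pow_word b 2) @ pow_word z l),
         (conj_word (pow_word a 2) b, inv_word (pow_word a 2) @ pow_word z l)})"

definition G2 :: "nat \<Rightarrow> nat \<Rightarrow> nat \<Rightarrow> gen word set monoid" where
  "G2 e k l = presented_group (G2_rels e k l)"

definition G2_a :: "nat \<Rightarrow> nat \<Rightarrow> nat \<Rightarrow> gen word set" where
  "G2_a e k l = pres_gen (G2_rels e k l) Gen_a"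

definition G2_b :: "nat \<Rightarrow> nat \<Rightarrow> nat \<Rightarrow> gen word set" where
  "G2_b e k l = pres_gen (G2_rels e k l) Gen_b"

definition aut_exponents :: "nat \<Rightarrow> int \<Rightarrow> int \<Rightarrow> int \<Rightarrow> int \<Rightarrow> bool" where
  "aut_exponents l i j f h \<longleftrightarrow>
     (odd i \<and> odd h \<and> even j \<and> even f \<or> even i \<and> even h \<and> odd j \<and> odd f) \<and>
     (l = 1 \<longrightarrow> [i + j = f + h] (mod 4))"

end

theory Submission
  imports Defs
begin

text \<open>
  Write \<open>n = 4q\<close> and \<open>z = a\<^sup>2\<^sup>q b\<^sup>2\<^sup>q\<close>. The relations make \<open>z\<close> central with \<open>z\<^sup>2 = 1\<close>, and
  \<open>b\<^sup>y a\<^sup>p = a\<^sup>\<plusminus>\<^sup>p b\<^sup>\<plusminus>\<^sup>y z\<^sup>c\<close>, where the signs are given by the parities of \<open>y\<close> and \<open>p\<close>, and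
  \<open>c\<close> depends on \<open>(y, p)\<close>. So every element is some \<open>a\<^sup>x b\<^sup>y z\<^sup>t\<close>, and products
  become integer arithmetic. For \<open>x = a\<^sup>i b\<^sup>j\<close>, \<open>y = a\<^sup>f b\<^sup>h\<close> with exponents as in (i), all
  relations other than the one for \<open>[y, x]\<close> hold automatically, and that one says that
  \<open>z\<close> to the power \<open>l (i + j - f - h) / 2\<close> is \<open>1\<close>. Such \<open>x\<close> and \<open>y\<close> generate the finite group, because
  odd powers of \<open>a\<close>, \<open>b\<close>, \<open>a\<^sup>2\<close> and \<open>b\<^sup>2\<close> can be extracted from the squares of \<open>x\<close> and \<open>y\<close>.

  Conversely, \<open>a\<^sup>x b\<^sup>y z\<^sup>t\<close> with \<open>x \<equiv> y (mod 2)\<close> has order dividing \<open>2q\<close>, whereas \<open>a\<close> and \<open>b\<close>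
  have order \<open>4q\<close>; with the exponent parity homomorphisms this forces (i). Condition (ii) then
  follows from \<open>z \<noteq> 1\<close>. That \<open>a\<^sup>2\<^sup>q\<close> and \<open>z\<close> are nontrivial is seen in the action of the group
  on the cosets of \<open>\<langle>b\<rangle>\<close>, identified with the integers modulo \<open>4q\<close>.
\<close>

section \<open>Arithmetic of the defining relations\<close>

lemma (in group) conj_int_pow:
  assumes "x \<in> carrier G" "y \<in> carrier G" "g \<in> carrier G" and eq: "x \<otimes> g = g \<otimes> y"
  shows "x [^] (i::int) \<otimes> g = g \<otimes> y [^] i"
proof -
  have n: "x [^] (m::nat) \<otimes> g = g \<otimes> y [^] m" for m
  proof (induction m)
    case (Suc m)
    have "x [^] Suc m \<otimes> g = x [^] m \<otimes> (x \<otimes> g)"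
      using assms by (simp add: m_assoc)
    also have "\<dots> = (x [^] m \<otimes> g) \<otimes> y"
      using assms by (simp add: m_assoc)
    also have "\<dots> = g \<otimes> y [^] Suc m"
      using assms by (simp add: Suc m_assoc)
    finally show ?case .
  qed (use assms in simp)
  show ?thesis
  proof (cases i rule: int_cases2)
    case (nonneg m) with n show ?thesis by (simp add: int_pow_int)
  next
    case (nonpos m)
    have "inv (x [^] m) \<otimes> g = inv (x [^] m) \<otimes> (g \<otimes> y [^] m) \<otimes> inv (y [^] m)"
      using assms by (simp add: m_assoc)
    also have "\<dots> = g \<otimes> inv (y [^] m)"
      using assms by (simp add: n[symmetric] m_assoc[symmetric])
    finally show ?thesis
      using nonpos assms by (simp add: int_pow_neg int_pow_int)
  qed
qed

lemma (in group) comm_int_pow: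
  assumes "x \<in> carrier G" "y \<in> carrier G" "x \<otimes> y = y \<otimes> x"
  shows "x [^] (i::int) \<otimes> y [^] (j::int) = y [^] j \<otimes> x [^] i"
  by (intro conj_int_pow HOL.sym[OF conj_int_pow]) (use assms in auto)

text \<open>Here n = 4q. The pair a, b is arbitrary, so the locale also applies to candidate images
  of the generators and to pairs in the integers modulo 2. The condition \<open>odd_q\<close> stands
  for k = l = 0 when n = 4, because 2^(e-2) is odd only for e = 2.\<close>

locale G2_relations = group G for G (structure) +
  fixes a b :: 'a and q k l :: int
  assumes a_closed [simp]: "a \<in> carrier G" and b_closed [simp]: "b \<in> carrier G"
    and a_order: "a [^] (4 * q) = \<one>" and b_order: "b [^] (4 * q) = \<one>"
    and squares_commute: "b [^] (2::int) \<otimes> a [^] (2::int) = a [^] (2::int) \<otimes> b [^] (2::int)"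
    and commutator: "b \<otimes> a = a \<otimes> b \<otimes> a [^] (2::int) \<otimes> b [^] (-2::int)
      \<otimes> (a [^] (2 * q) \<otimes> b [^] (2 * q)) [^] k"
    and b_square_conj: "b [^] (2::int) \<otimes> a
      = a \<otimes> b [^] (-2::int) \<otimes> (a [^] (2 * q) \<otimes> b [^] (2 * q)) [^] l"
    and a_square_conj: "a [^] (2::int) \<otimes> b
      = b \<otimes> a [^] (-2::int) \<otimes> (a [^] (2 * q) \<otimes> b [^] (2 * q)) [^] l"
    and odd_q: "odd q \<Longrightarrow> k = 0 \<and> l = 0"
begin

abbreviation A :: "int \<Rightarrow> 'a" where "A i \<equiv> a [^] i"
abbreviation B :: "int \<Rightarrow> 'a" where "B i \<equiv> b [^] i"

definition z where "z = A (2 * q) \<otimes> B (2 * q)"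

abbreviation Z :: "int \<Rightarrow> 'a" where "Z i \<equiv> z [^] i"

lemma z_closed [simp]: "z \<in> carrier G"
  by (simp add: z_def)

section \<open>Even powers and the central element z\<close>

lemma even_pow:
  assumes "x \<in> carrier G" shows "(x [^] (2::int)) [^] (r::int) = x [^] (2 * r)"
  using assms by (simp add: int_pow_pow)

lemma even_powers_commute: "B (2 * s) \<otimes> A (2 * r) = A (2 * r) \<otimes> B (2 * s)"
  using comm_int_pow[OF _ _ squares_commute, of s r] by (simp add: even_pow)

text \<open>z is a product of even powers, and the squares commute. This partial centrality is what
  lets powers of b^-2 z^l and a^-2 z^l be distributed in \<open>b_even_conj\<close> and
  \<open>a_even_conj\<close>.\<close>

lemma z_pow_commute_even:
  "Z t \<otimes> A (2 * r) = A (2 * r) \<otimes> Z t"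
  "Z t \<otimes> B (2 * r) = B (2 * r) \<otimes> Z t"
proof -
  have "z \<otimes> A (2 * r) = A (2 * r) \<otimes> z"
    by (simp add: z_def m_assoc even_powers_commute)
       (simp add: m_assoc[symmetric] int_pow_mult[symmetric] add.commute)
  then show "Z t \<otimes> A (2 * r) = A (2 * r) \<otimes> Z t"
    by (intro conj_int_pow) auto
  have "z \<otimes> B (2 * r) = B (2 * r) \<otimes> z"
    by (simp add: z_def m_assoc[symmetric] even_powers_commute)
       (simp add: m_assoc int_pow_mult[symmetric] add.commute)
  then show "Z t \<otimes> B (2 * r) = B (2 * r) \<otimes> Z t"
    by (intro conj_int_pow) auto
qed

lemma z_pow_even: "even t \<Longrightarrow> Z t = \<one>"
proof -
  assume "even t"
  then obtain s where t: "t = 2 * s" by blast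
  have "Z t = A (2 * q * t) \<otimes> B (2 * q * t)"
    by (simp add: z_def int_pow_mult_distrib even_powers_commute int_pow_pow)
  also have "\<dots> = (A (4 * q)) [^] s \<otimes> (B (4 * q)) [^] s"
    by (simp add: int_pow_pow t algebra_simps)
  also have "\<dots> = \<one>" by (simp add: a_order b_order)
  finally show ?thesis .
qed

lemma z_pow_cong: "even (s - t) \<Longrightarrow> Z s = Z t"
  using z_pow_even[of "s - t"] int_pow_mult[of z t "s - t"] by simp

lemma b_even_conj: "B (2 * s) \<otimes> a = a \<otimes> B (- 2 * s) \<otimes> Z (l * s)"
proof -
  have "B (2 * s) \<otimes> a = a \<otimes> (B (- 2) \<otimes> Z l) [^] s"
    using conj_int_pow[of "B 2" "B (- 2) \<otimes> Z l" a s] b_square_conj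
    by (simp add: z_def even_pow m_assoc)
  also have "(B (- 2) \<otimes> Z l) [^] s = B (- 2 * s) \<otimes> Z (l * s)"
    using z_pow_commute_even(2)[of l "-1"]
    by (subst int_pow_mult_distrib) (simp_all add: int_pow_pow)
  finally show ?thesis by (simp add: m_assoc)
qed

lemma a_even_conj: "A (2 * s) \<otimes> b = b \<otimes> A (- 2 * s) \<otimes> Z (l * s)"
proof -
  have "A (2 * s) \<otimes> b = b \<otimes> (A (- 2) \<otimes> Z l) [^] s"
    using conj_int_pow[of "A 2" "A (- 2) \<otimes> Z l" b s] a_square_conj
    by (simp add: z_def even_pow m_assoc)
  also have "(A (- 2) \<otimes> Z l) [^] s = A (- 2 * s) \<otimes> Z (l * s)"
    using z_pow_commute_even(1)[of l "-1"]
    by (subst int_pow_mult_distrib) (simp_all add: int_pow_pow)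
  finally show ?thesis by (simp add: m_assoc)
qed

text \<open>Either q is even or k = l = 0. Hence z to a multiple of lq or kq is trivial.\<close>

lemma even_l_q: "even (l * q)" and even_k_q: "even (k * q)"
  using odd_q by auto

lemma pow_cong:
  assumes "x \<in> carrier G" "x [^] (4 * q) = \<one>" "[i = j] (mod 4 * q)"
  shows "x [^] (i::int) = x [^] (j::int)"
proof -
  obtain r where "i = j + 4 * q * r" using assms(3) by (metis cong_iff_lin cong_sym)
  then have "x [^] i = x [^] j \<otimes> (x [^] (4 * q)) [^] r"
    using assms(1) by (simp add: int_pow_mult int_pow_pow)
  then show ?thesis using assms by simp
qed

lemmas a_pow_cong = pow_cong[OF a_closed a_order] and b_pow_cong = pow_cong[OF b_closed b_order]

text \<open>Since 4q kills a and b, the powers a^(2q) and b^(2q) are their own inverses. At s = q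
  the inverting relations, with z^(lq) = 1, therefore turn into commutation of b^(2q) with a and of
  a^(2q) with b.\<close>

lemma z_central_generators: "z \<otimes> a = a \<otimes> z" "z \<otimes> b = b \<otimes> z"
proof -
  have 1: "A (- 2 * q) = A (2 * q)" "B (- 2 * q) = B (2 * q)"
    by (rule a_pow_cong b_pow_cong; simp add: cong_iff_dvd_diff)+
  have "B (2 * q) \<otimes> a = a \<otimes> B (2 * q)"
    using b_even_conj[of q] 1 z_pow_even[OF even_l_q] by simp
  then show "z \<otimes> a = a \<otimes> z"
    by (simp add: z_def m_assoc) (simp add: m_assoc[symmetric] conj_int_pow)
  have "A (2 * q) \<otimes> b = b \<otimes> A (2 * q)"
    using a_even_conj[of q] 1 z_pow_even[OF even_l_q] by simp
  then have "b \<otimes> z = A (2 * q) \<otimes> (b \<otimes> B (2 * q))"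
    by (simp add: z_def m_assoc[symmetric])
  also have "b \<otimes> B (2 * q) = B (2 * q) \<otimes> b"
    by (rule HOL.sym, rule conj_int_pow) simp_all
  also have "A (2 * q) \<otimes> (B (2 * q) \<otimes> b) = z \<otimes> b"
    by (simp add: z_def m_assoc)
  finally show "z \<otimes> b = b \<otimes> z" ..
qed

lemma z_central:
  "Z t \<otimes> A (i) = A i \<otimes> Z t"
  "Z t \<otimes> B (i) = B i \<otimes> Z t"
  by (intro comm_int_pow z_central_generators; simp)+

lemma merge_pows_left:
  assumes "x \<in> carrier G" "w \<in> carrier G"
  shows "x [^] (i::int) \<otimes> (x [^] (j::int) \<otimes> w) = x [^] (i + j) \<otimes> w"
  using assms by (simp add: int_pow_mult m_assoc)

lemma z_central_left:
  assumes "w \<in> carrier G"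
  shows "Z t \<otimes> (A i \<otimes> w) = A i \<otimes> (Z t \<otimes> w)"
    and "Z t \<otimes> (B i \<otimes> w) = B i \<otimes> (Z t \<otimes> w)"
  using assms z_central by (simp_all flip: m_assoc)

text \<open>Rewrite rules that merge adjacent powers of the same element and push powers of z to the
  right.\<close>

lemmas collect =
  merge_pows_left[OF a_closed] merge_pows_left[OF b_closed] merge_pows_left[OF z_closed]
  int_pow_mult[OF a_closed, symmetric] int_pow_mult[OF b_closed, symmetric]
  int_pow_mult[OF z_closed, symmetric]
  z_central z_central_left m_assoc

section \<open>Moving powers of b past powers of a\<close>

text \<open>The exponent of \<open>z\<close> that arises when \<open>b\<^sup>y\<close> is moved past \<open>a\<^sup>p\<close>.\<close>

definition twist :: "int \<Rightarrow> int \<Rightarrow> int" where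
  "twist y p =
    (if even y then if even p then 0 else l * (y div 2)
     else if even p then l * (p div 2) else k + l * ((y + p) div 2))"

lemma even_odd_swap: "B (2 * s) \<otimes> A (2 * r + 1) = A (2 * r + 1) \<otimes> B (- 2 * s) \<otimes> Z (l * s)"
proof -
  have "B (2 * s) \<otimes> A (2 * r + 1) = B (2 * s) \<otimes> A (2 * r) \<otimes> a"
    by (simp add: int_pow_mult m_assoc)
  also have "\<dots> = A (2 * r) \<otimes> (B (2 * s) \<otimes> a)"
    by (simp add: even_powers_commute m_assoc)
  finally show ?thesis
    by (simp add: b_even_conj int_pow_mult m_assoc)
qed

lemma odd_even_swap: "B (2 * s + 1) \<otimes> A (2 * r) = A (- 2 * r) \<otimes> B (2 * s + 1) \<otimes> Z (l * r)"
proof -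
  have "A (- 2 * r) \<otimes> b \<otimes> Z (l * r) = b \<otimes> A (2 * r) \<otimes> (Z (- l * r) \<otimes> Z (l * r))"
    using a_even_conj[of "- r"] by (simp add: m_assoc)
  then have 1: "b \<otimes> A (2 * r) = A (- 2 * r) \<otimes> b \<otimes> Z (l * r)"
    by (simp flip: int_pow_mult)
  have "B (2 * s + 1) \<otimes> A (2 * r) = B (2 * s) \<otimes> (b \<otimes> A (2 * r))"
    by (simp add: int_pow_mult m_assoc)
  also have "\<dots> = B (2 * s) \<otimes> A (2 * - r) \<otimes> (b \<otimes> Z (l * r))"
    by (simp add: 1 m_assoc)
  also have "\<dots> = A (2 * - r) \<otimes> (B (2 * s) \<otimes> (b \<otimes> Z (l * r)))"
    by (simp only: even_powers_commute) (simp add: m_assoc)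
  finally show ?thesis
    by (simp add: int_pow_mult m_assoc)
qed

text \<open>The commutator relation reads ba = a b a^2 b^-2 z^k, and moving b past a^2 turns this
  into a a^-2 b b^-2 with one more factor z^l.\<close>

lemma ba_eq: "b \<otimes> a = A (- 1) \<otimes> B (- 1) \<otimes> Z (k + l)"
proof -
  have "b \<otimes> a = A 1 \<otimes> (B 1 \<otimes> A 2) \<otimes> B (- 2) \<otimes> Z k"
    using commutator by (simp add: z_def m_assoc)
  also have "B 1 \<otimes> A 2 = A (- 2) \<otimes> B 1 \<otimes> Z l"
    using odd_even_swap[of 0 1] by simp
  finally show ?thesis
    by (simp add: collect add.commute del: int_pow_1)
qed

lemma odd_odd_swap: "B (2 * s + 1) \<otimes> A (2 * r + 1)
  = A (- (2 * r + 1)) \<otimes> B (- (2 * s + 1)) \<otimes> Z (k + l * (r + s + 1))"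
proof -
  have "B (2 * s + 1) \<otimes> A (2 * r + 1) = (B (2 * s + 1) \<otimes> A (2 * r)) \<otimes> a"
    by (simp add: int_pow_mult m_assoc)
  also have "\<dots> = A (- 2 * r) \<otimes> (B (2 * s) \<otimes> (b \<otimes> a)) \<otimes> Z (l * r)"
    unfolding odd_even_swap using z_central(1)[of "l * r" 1]
    by (simp add: int_pow_mult m_assoc)
  \<comment> \<open>The exponent -1 is written as 2 * - 1 + 1 to fit \<open>even_odd_swap\<close>
    with r = -1.\<close>
  also have "B (2 * s) \<otimes> (b \<otimes> a) = (B (2 * s) \<otimes> A (2 * - 1 + 1)) \<otimes> B (- 1) \<otimes> Z (k + l)"
    by (simp add: ba_eq m_assoc)
  also have "B (2 * s) \<otimes> A (2 * - 1 + 1) = A (- 1) \<otimes> B (- 2 * s) \<otimes> Z (l * s)"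
    by (simp only: even_odd_swap) simp
  finally show ?thesis
    by (simp add: collect algebra_simps)
qed

lemma swap: "B y \<otimes> A p
  = A (if even y then p else - p) \<otimes> B (if even p then y else - y) \<otimes> Z (twist y p)"
proof -
  define s r where "s = y div 2" and "r = p div 2"
  then have y: "y = (if even y then 2 * s else 2 * s + 1)"
    and p: "p = (if even p then 2 * r else 2 * r + 1)" by simp_all
  show ?thesis
  proof (cases "even y"; cases "even p")
    assume "even y" "even p"
    with y p even_powers_commute[of s r] show ?thesis by (simp add: twist_def)
  next
    assume "even y" "odd p"
    with y p even_odd_swap[of s r] show ?thesis by (simp add: twist_def s_def)
  next
    assume "odd y" "even p"
    with y p odd_even_swap[of s r] show ?thesis by (simp add: twist_def r_def)
  next
    assume "odd y" "odd p"
    with y p odd_odd_swap[of s r] show ?thesis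
      by (simp add: twist_def add_ac del: minus_add_distrib)
  qed
qed

section \<open>Normal forms and their products\<close>

definition N :: "int \<Rightarrow> int \<Rightarrow> int \<Rightarrow> 'a" where
  "N x y t = A x \<otimes> B y \<otimes> Z t"

lemma N_closed [simp]: "N x y t \<in> carrier G"
  by (simp add: N_def)

text \<open>Only the inner factor b^y a^p has to be swapped. With the power of z as a separate
  coordinate, the exponents of a and b just combine with signs.\<close>

lemma N_mult: "N x y t \<otimes> N p r s =
  N (x + (if even y then p else - p)) ((if even p then y else - y) + r) (t + s + twist y p)"
proof -
  have "N x y t \<otimes> N p r s = A x \<otimes> (B y \<otimes> A p) \<otimes> B r \<otimes> Z (t + s)"
    by (simp add: N_def collect)
  then show ?thesis
    unfolding swap by (simp add: N_def collect add.commute)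
qed

lemma N_cong:
  assumes "[x = x'] (mod 4 * q)" "[y = y'] (mod 4 * q)" "[t = t'] (mod 2)"
  shows "N x y t = N x' y' t'"
  using a_pow_cong[OF assms(1)] b_pow_cong[OF assms(2)] assms(3) z_pow_cong[of t t']
  by (simp add: N_def cong_iff_dvd_diff)

lemma N_eq_iff: "N x y t = N x y t' \<longleftrightarrow> Z (t - t') = \<one>"
proof -
  have "Z t = Z (t - t') \<otimes> Z t'" by (simp flip: int_pow_mult)
  then have "Z t = Z t' \<longleftrightarrow> Z (t - t') = \<one>"
    using r_cancel_one[of "Z t'" "Z (t - t')"] by simp
  then show ?thesis by (simp add: N_def)
qed

lemma N_0: "N 0 0 0 = \<one>" and a_eq_N: "a = N 1 0 0" and b_eq_N: "b = N 0 1 0"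
  and ab_eq_N: "A x \<otimes> B y = N x y 0"
  by (simp_all add: N_def)

lemma N_even_pow:
  assumes "even x" "even y"
  shows "N x y t [^] (s::int) = N (s * x) (s * y) (s * t)"
proof -
  have comm: "A x \<otimes> B y = B y \<otimes> A x"
    using assms by (elim evenE) (simp add: even_powers_commute)
  have "N x y t [^] s = (A x \<otimes> B y) [^] s \<otimes> Z t [^] s"
    unfolding N_def by (intro int_pow_mult_distrib) (simp_all add: collect)
  also have "(A x \<otimes> B y) [^] s = A x [^] s \<otimes> B y [^] s"
    using comm by (intro int_pow_mult_distrib) simp_all
  finally show ?thesis
    by (simp add: N_def int_pow_pow mult.commute)
qed

text \<open>The exponent t disappears because z^2 = 1. A sign change in \<open>swap\<close> makes
  the exponent of a, or of b, cancel in the square.\<close>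

lemma N_square: "N x y t [^] (2::int) =
    N (x + (if even y then x else - x)) ((if even x then y else - y) + y) (twist y x)"
proof -
  have "N x y t [^] (2::int) = N x y t \<otimes> N x y t"
    using int_pow_mult[of "N x y t" 1 1] by simp
  also have "\<dots> = N (x + (if even y then x else - x)) ((if even x then y else - y) + y) (twist y x)"
    unfolding N_mult by (intro N_cong) (simp_all add: cong_def)
  finally show ?thesis .
qed

text \<open>The factor z^t = a^(2qt) b^(2qt) is absorbed into the other two powers; the twist this
  causes is a multiple of lq, hence even.\<close>

lemma N_eq_ab:
  "N x y t = A (x + (if even y then 2 * q * t else - (2 * q * t))) \<otimes> B (y + 2 * q * t)"
proof -
  have "Z t = A (2 * q * t) \<otimes> B (2 * q * t)"
    using even_powers_commute[of q q] by (simp add: z_def int_pow_mult_distrib int_pow_pow)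
  then have "N x y t = N x y 0 \<otimes> N (2 * q * t) (2 * q * t) 0"
    by (simp add: N_def)
  also have "\<dots> = N (x + (if even y then 2 * q * t else - (2 * q * t))) (y + 2 * q * t) 0"
    unfolding N_mult using even_l_q by (intro N_cong) (auto simp: twist_def cong_0_iff)
  finally show ?thesis by (simp add: ab_eq_N)
qed

text \<open>Exponents matter only modulo 4q, 4q and 2. Finiteness later makes surjective
  endomorphisms bijective.\<close>

lemma finite_N: "finite {N x y t |x y t. True}" if "q > 0"
proof -
  have "{N x y t |x y t. True} \<subseteq> (\<lambda>(x, y, t). N x y t) ` ({0..<4 * q} \<times> {0..<4 * q} \<times> {0..<2})"
  proof clarify
    fix x y t
    have "N x y t = N (x mod (4 * q)) (y mod (4 * q)) (t mod 2)"
      by (intro N_cong) (simp_all add: cong_def)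
    then show "N x y t \<in> (\<lambda>(x, y, t). N x y t) ` ({0..<4 * q} \<times> {0..<4 * q} \<times> {0..<2})"
      using that by (intro image_eqI[of _ _ "(x mod (4 * q), y mod (4 * q), t mod 2)"]) auto
  qed
  then show ?thesis by (rule finite_subset) simp
qed

section \<open>The defining relations at candidate images of the generators\<close>

lemma N_eqI: "x = x' \<Longrightarrow> y = y' \<Longrightarrow> t = t' \<Longrightarrow> N x y t = N x' y' t'"
  by simp

lemma Z_eq_N: "Z t = N 0 0 t"
  by (simp add: N_def)

text \<open>The commutator relation is left out because it alone depends on condition (ii). The
  fourth conjunct says that x, y produce the same z as a, b, so the original z can be used in the
  last two.\<close>

definition other_relations :: "'a \<Rightarrow> 'a \<Rightarrow> bool" where
  "other_relations x y \<longleftrightarrow>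
     x [^] (4 * q) = \<one> \<and> y [^] (4 * q) = \<one> \<and>
     y [^] (2::int) \<otimes> x [^] (2::int) = x [^] (2::int) \<otimes> y [^] (2::int) \<and>
     x [^] (2 * q) \<otimes> y [^] (2 * q) = z \<and>
     y [^] (2::int) \<otimes> x = x \<otimes> y [^] (-2::int) \<otimes> Z l \<and>
     x [^] (2::int) \<otimes> y = y \<otimes> x [^] (-2::int) \<otimes> Z l"

text \<open>Squaring x cancels its power of b, and squaring y its power of a. So x^2 and y^2 are
  powers of a and of b up to z, and \<open>N_even_pow\<close> yields all their powers.\<close>

lemma straight_images:
  fixes i j f h :: int
  defines "x \<equiv> N (2 * i + 1) (2 * j) 0" and "y \<equiv> N (2 * f) (2 * h + 1) 0"
  shows "other_relations x y"
    and "y \<otimes> x = x \<otimes> y \<otimes> x [^] (2::int) \<otimes> y [^] (-2::int) \<otimes> Z k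
         \<longleftrightarrow> Z (l * (i + j - f - h)) = \<one>"
proof -
  have [simp]: "x \<in> carrier G" "y \<in> carrier G" by (simp_all add: x_def y_def)
  have x2: "x [^] (2::int) = N (4 * i + 2) 0 (l * j)"
    unfolding x_def N_square by (intro N_eqI) (simp_all add: twist_def)
  have y2: "y [^] (2::int) = N 0 (4 * h + 2) (l * f)"
    unfolding y_def N_square by (intro N_eqI) (simp_all add: twist_def)
  have x_pow: "x [^] (2 * s) = N (s * (4 * i + 2)) 0 (s * (l * j))" for s
    by (simp add: x2 N_even_pow flip: even_pow)
  have y_pow: "y [^] (2 * s) = N 0 (s * (4 * h + 2)) (s * (l * f))" for s
    by (simp add: y2 N_even_pow flip: even_pow)
  note x_inv = x_pow[of "-1", simplified] and y_inv = y_pow[of "-1", simplified]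
  have [simp]: "- (r * 4) div 2 = - (r * 2)" for r :: int by presburger
  have "x [^] (4 * q) = N 0 0 0"
    using x_pow[of "2 * q"] by (simp, intro N_cong) (simp_all add: cong_0_iff algebra_simps)
  moreover have "y [^] (4 * q) = N 0 0 0"
    using y_pow[of "2 * q"] by (simp, intro N_cong) (simp_all add: cong_0_iff algebra_simps)
  moreover have "x [^] (2 * q) = N (2 * q) 0 0"
    unfolding x_pow using even_l_q by (intro N_cong) (auto simp: cong_iff_dvd_diff algebra_simps)
  moreover have "y [^] (2 * q) = N 0 (2 * q) 0"
    unfolding y_pow using even_l_q by (intro N_cong) (auto simp: cong_iff_dvd_diff algebra_simps)
  moreover have "y [^] (2::int) \<otimes> x [^] (2::int) = x [^] (2::int) \<otimes> y [^] (2::int)"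
    unfolding x2 y2 N_mult by (intro N_eqI) (simp_all add: twist_def)
  moreover have "y [^] (2::int) \<otimes> x = x \<otimes> y [^] (-2::int) \<otimes> Z l"
    unfolding y_inv y2 Z_eq_N unfolding x_def N_mult
    by (intro N_cong) (simp_all add: twist_def cong_iff_dvd_diff algebra_simps)
  moreover have "x [^] (2::int) \<otimes> y = y \<otimes> x [^] (-2::int) \<otimes> Z l"
    unfolding x_inv x2 Z_eq_N unfolding y_def N_mult
    by (intro N_cong) (simp_all add: twist_def cong_iff_dvd_diff algebra_simps)
  ultimately show "other_relations x y"
    unfolding other_relations_def by (simp add: N_def z_def)
  have left: "y \<otimes> x = N (2 * f - 2 * i - 1) (2 * j - 2 * h - 1) (k + l * (h + i + 1))"
    unfolding x_def y_def N_mult by (intro N_eqI) (simp_all add: twist_def algebra_simps)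
  have right: "x \<otimes> y \<otimes> x [^] (2::int) \<otimes> y [^] (-2::int) \<otimes> Z k =
      N (2 * f - 2 * i - 1) (2 * j - 2 * h - 1) (l * (j - f) + l * (2 * i + 1) + k)"
    unfolding y_inv x2 Z_eq_N unfolding x_def y_def N_mult
    by (intro N_eqI) (simp_all add: twist_def algebra_simps)
  \<comment> \<open>Both sides have the same exponents of a and b, so the relation compares
    exponents of z only; these differ by l(i + j - f - h) up to sign.\<close>
  show "y \<otimes> x = x \<otimes> y \<otimes> x [^] (2::int) \<otimes> y [^] (-2::int) \<otimes> Z k
         \<longleftrightarrow> Z (l * (i + j - f - h)) = \<one>"
    unfolding left right N_eq_iff
    using z_pow_cong[of "k + l * (h + i + 1) - (l * (j - f) + l * (2 * i + 1) + k)"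
        "l * (i + j - f - h)"]
    by (simp add: algebra_simps)
qed

text \<open>The same computation with the roles exchanged: up to z, x^2 is now a power of b and y^2
  a power of a.\<close>

lemma crossed_images:
  fixes i j f h :: int
  defines "x \<equiv> N (2 * i) (2 * j + 1) 0" and "y \<equiv> N (2 * f + 1) (2 * h) 0"
  shows "other_relations x y"
    and "y \<otimes> x = x \<otimes> y \<otimes> x [^] (2::int) \<otimes> y [^] (-2::int) \<otimes> Z k
         \<longleftrightarrow> Z (l * (i + j - f - h)) = \<one>"
proof -
  have [simp]: "x \<in> carrier G" "y \<in> carrier G" by (simp_all add: x_def y_def)
  have x2: "x [^] (2::int) = N 0 (4 * j + 2) (l * i)"
    unfolding x_def N_square by (intro N_eqI) (simp_all add: twist_def)
  have y2: "y [^] (2::int) = N (4 * f + 2) 0 (l * h)"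
    unfolding y_def N_square by (intro N_eqI) (simp_all add: twist_def)
  have x_pow: "x [^] (2 * s) = N 0 (s * (4 * j + 2)) (s * (l * i))" for s
    by (simp add: x2 N_even_pow flip: even_pow)
  have y_pow: "y [^] (2 * s) = N (s * (4 * f + 2)) 0 (s * (l * h))" for s
    by (simp add: y2 N_even_pow flip: even_pow)
  note x_inv = x_pow[of "-1", simplified] and y_inv = y_pow[of "-1", simplified]
  have [simp]: "- (r * 4) div 2 = - (r * 2)" for r :: int by presburger
  have "x [^] (4 * q) = N 0 0 0"
    using x_pow[of "2 * q"] by (simp, intro N_cong) (simp_all add: cong_0_iff algebra_simps)
  moreover have "y [^] (4 * q) = N 0 0 0"
    using y_pow[of "2 * q"] by (simp, intro N_cong) (simp_all add: cong_0_iff algebra_simps)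
  moreover have "x [^] (2 * q) = N 0 (2 * q) 0"
    unfolding x_pow using even_l_q by (intro N_cong) (auto simp: cong_iff_dvd_diff algebra_simps)
  moreover have "y [^] (2 * q) = N (2 * q) 0 0"
    unfolding y_pow using even_l_q by (intro N_cong) (auto simp: cong_iff_dvd_diff algebra_simps)
  moreover have "y [^] (2::int) \<otimes> x [^] (2::int) = x [^] (2::int) \<otimes> y [^] (2::int)"
    unfolding x2 y2 N_mult by (intro N_eqI) (simp_all add: twist_def)
  moreover have "y [^] (2::int) \<otimes> x = x \<otimes> y [^] (-2::int) \<otimes> Z l"
    unfolding y_inv y2 Z_eq_N unfolding x_def N_mult
    by (intro N_cong) (simp_all add: twist_def cong_iff_dvd_diff algebra_simps)
  moreover have "x [^] (2::int) \<otimes> y = y \<otimes> x [^] (-2::int) \<otimes> Z l"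
    unfolding x_inv x2 Z_eq_N unfolding y_def N_mult
    by (intro N_cong) (simp_all add: twist_def cong_iff_dvd_diff algebra_simps)
  ultimately show "other_relations x y"
    unfolding other_relations_def using even_powers_commute[of q q] by (simp add: N_def z_def)
  have left: "y \<otimes> x = N (2 * f + 2 * i + 1) (2 * h + 2 * j + 1) 0"
    unfolding x_def y_def N_mult by (intro N_eqI) (simp_all add: twist_def algebra_simps)
  \<comment> \<open>One k comes from swapping odd powers inside xy and one from the relation itself;
    together they vanish modulo 2.\<close>
  have right: "x \<otimes> y \<otimes> x [^] (2::int) \<otimes> y [^] (-2::int) \<otimes> Z k =
      N (2 * f + 2 * i + 1) (2 * h + 2 * j + 1)
        (2 * k + l * (j + f + 1) + l * (i - h) - l * (2 * f + 1))"
    unfolding y_inv x2 Z_eq_N unfolding x_def y_def N_mult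
    by (intro N_eqI) (simp_all add: twist_def algebra_simps)
  show "y \<otimes> x = x \<otimes> y \<otimes> x [^] (2::int) \<otimes> y [^] (-2::int) \<otimes> Z k
         \<longleftrightarrow> Z (l * (i + j - f - h)) = \<one>"
    unfolding left right N_eq_iff
    using z_pow_cong[of "0 - (2 * k + l * (j + f + 1) + l * (i - h) - l * (2 * f + 1))"
        "l * (i + j - f - h)"]
    by (simp add: algebra_simps)
qed

definition exponent_parity :: "int \<Rightarrow> int \<Rightarrow> int \<Rightarrow> int \<Rightarrow> bool" where
  "exponent_parity i j f h \<longleftrightarrow>
     odd i \<and> odd h \<and> even j \<and> even f \<or> even i \<and> even h \<and> odd j \<and> odd f"

text \<open>In either parity pattern the two odd offsets cancel in i + j - f - h, so half of it is
  the difference of the halved exponents, and both patterns give one condition.\<close>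

lemma images:
  fixes i j f h :: int
  assumes "exponent_parity i j f h"
  defines "x \<equiv> A i \<otimes> B j" and "y \<equiv> A f \<otimes> B h"
  shows "other_relations x y"
    and "y \<otimes> x = x \<otimes> y \<otimes> x [^] (2::int) \<otimes> y [^] (-2::int) \<otimes> Z k
      \<longleftrightarrow> Z (l * ((i + j - f - h) div 2)) = \<one>"
proof -
  have "other_relations x y \<and>
    (y \<otimes> x = x \<otimes> y \<otimes> x [^] (2::int) \<otimes> y [^] (-2::int) \<otimes> Z k
      \<longleftrightarrow> Z (l * ((i + j - f - h) div 2)) = \<one>)"
    using assms(1) unfolding exponent_parity_def x_def y_def ab_eq_N
  proof (elim disjE conjE evenE oddE, goal_cases)
    case (1 j' f' i' h')
    then have div: "(i + j - f - h) div 2 = i' + j' - f' - h'" by presburger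
    from straight_images[where i = i' and j = j' and f = f' and h = h'] show ?case
      unfolding div unfolding 1 by blast
  next
    case (2 i' h' j' f')
    then have div: "(i + j - f - h) div 2 = i' + j' - f' - h'" by presburger
    from crossed_images[where i = i' and j = j' and f = f' and h = h'] show ?case
      unfolding div unfolding 2 by blast
  qed
  then show "other_relations x y"
    and "y \<otimes> x = x \<otimes> y \<otimes> x [^] (2::int) \<otimes> y [^] (-2::int) \<otimes> Z k
      \<longleftrightarrow> Z (l * ((i + j - f - h) div 2)) = \<one>"
    by simp_all
qed

lemma images_relations:
  assumes "exponent_parity i j f h" "Z (l * ((i + j - f - h) div 2)) = \<one>"
  shows "G2_relations G (A i \<otimes> B j) (A f \<otimes> B h) q k l"
  using images[OF assms(1)] assms(2) odd_q
  by unfold_locales (simp_all add: other_relations_def)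

section \<open>Recovering the generators from their images\<close>

lemma subgroup_odd_power:
  assumes "subgroup H G" "x \<in> carrier G" "x [^] (4 * q) = \<one>" "q = 2 ^ m" "odd i" "x [^] (i::int) \<in> H"
  shows "x \<in> H"
proof -
  \<comment> \<open>The order of x divides 4q = 2^(m+2), so Bezout writes x as a power of
    x^i.\<close>
  have "coprime i (2 ^ (m + 2))"
    using \<open>odd i\<close> by (subst coprime_power_right_iff) simp
  then have "coprime i (4 * q)"
    by (simp add: assms(4) mult.commute)
  then obtain r s where "r * i + s * (4 * q) = 1"
    using bezout_int[of i "4 * q"] by auto
  then have "i * r + 4 * q * s = 1" by (simp add: mult.commute)
  then have "x [^] (1::int) = x [^] (i * r) \<otimes> x [^] (4 * q * s)"
    using int_pow_mult[OF assms(2), of "i * r" "4 * q * s"] by argo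
  also have "\<dots> = (x [^] i) [^] r \<otimes> (x [^] (4 * q)) [^] s"
    unfolding int_pow_pow[OF assms(2)] ..
  also have "\<dots> = (x [^] i) [^] r"
    unfolding assms(3) using assms(2) by simp
  also have "\<dots> \<in> H"
    using subgroup_int_pow_closed[OF assms(1,6)] .
  finally show ?thesis using assms(2) by simp
qed

lemma subgroup_cancel:
  assumes "subgroup H G" "x \<in> carrier G" "w \<in> H"
  shows "x \<otimes> w \<in> H \<longleftrightarrow> x \<in> H" and "w \<otimes> x \<in> H \<longleftrightarrow> x \<in> H"
proof -
  have w: "w \<in> carrier G" using subgroup.mem_carrier[OF assms(1,3)] .
  have 1: "x = (x \<otimes> w) \<otimes> inv w"
    using w assms(2) by (simp add: m_assoc)
  have 2: "x = inv w \<otimes> (w \<otimes> x)"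
    using w assms(2) m_assoc[of "inv w" w x] by simp
  have "inv w \<in> H" using subgroup.m_inv_closed[OF assms(1,3)] .
  then show "x \<otimes> w \<in> H \<longleftrightarrow> x \<in> H" "w \<otimes> x \<in> H \<longleftrightarrow> x \<in> H"
    using 1 2 subgroup.m_closed[OF assms(1)] assms(3) by metis+
qed

text \<open>In the first pattern, x^2 gives a^(2i) up to z, which lies in H. As i is odd, all even
  powers of a follow, in particular a^f; cancelling it from y leaves the odd power b^h and hence b.
  The rest is symmetric.\<close>

lemma images_generate:
  assumes parity: "exponent_parity i j f h" and q: "q = 2 ^ m" and H: "subgroup H G"
    and x: "A i \<otimes> B j \<in> H" and y: "A f \<otimes> B h \<in> H" and "z \<in> H"
  shows "a \<in> H" "b \<in> H"
proof -
  have Z: "Z t \<in> H" for t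
    using subgroup_int_pow_closed[OF H \<open>z \<in> H\<close>] .
  have pow2: "(A i \<otimes> B j) [^] (2::int) \<in> H" "(A f \<otimes> B h) [^] (2::int) \<in> H"
    using subgroup_int_pow_closed[OF H] x y by blast+
  have a_root: "a \<in> H" if "A r \<in> H" "odd r" for r
    using subgroup_odd_power[OF H a_closed a_order q] that by blast
  have b_root: "b \<in> H" if "B r \<in> H" "odd r" for r
    using subgroup_odd_power[OF H b_closed b_order q] that by blast
  have a2: "A (2 * s) \<in> H" if "A (2 * r) \<in> H" "odd r" for r s
  proof -
    have "(A 2) [^] (4 * q) = (A (4 * q)) [^] (2::int)"
      by (simp add: int_pow_pow mult.commute)
    then have "A 2 \<in> H"
      using subgroup_odd_power[OF H _ _ q, of "A 2" r] that by (simp add: int_pow_pow a_order)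
    then show ?thesis using subgroup_int_pow_closed[OF H, of "A 2" s] by (simp add: int_pow_pow)
  qed
  have b2: "B (2 * s) \<in> H" if "B (2 * r) \<in> H" "odd r" for r s
  proof -
    have "(B 2) [^] (4 * q) = (B (4 * q)) [^] (2::int)"
      by (simp add: int_pow_pow mult.commute)
    then have "B 2 \<in> H"
      using subgroup_odd_power[OF H _ _ q, of "B 2" r] that by (simp add: int_pow_pow b_order)
    then show ?thesis using subgroup_int_pow_closed[OF H, of "B 2" s] by (simp add: int_pow_pow)
  qed
  have "a \<in> H \<and> b \<in> H"
    using parity unfolding exponent_parity_def
  proof (elim disjE conjE, goal_cases)
    case straight: 1
    have "A (2 * i) \<in> H"
      using pow2(1) straight subgroup_cancel(1)[OF H _ Z, of "A (2 * i)"]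
      by (simp add: ab_eq_N N_square) (simp add: N_def)
    with a2[of i "f div 2"] straight have f: "A f \<in> H" by simp
    have "B (2 * h) \<in> H"
      using pow2(2) straight subgroup_cancel(1)[OF H _ Z, of "B (2 * h)"]
      by (simp add: ab_eq_N N_square) (simp add: N_def)
    with b2[of h "j div 2"] straight have j: "B j \<in> H" by simp
    show ?case
      using a_root[of i] b_root[of h] x y straight
      by (simp add: subgroup_cancel(1)[OF H _ j] subgroup_cancel(2)[OF H _ f])
  next
    case crossed: 2
    have "A (2 * f) \<in> H"
      using pow2(2) crossed subgroup_cancel(1)[OF H _ Z, of "A (2 * f)"]
      by (simp add: ab_eq_N N_square) (simp add: N_def)
    with a2[of f "i div 2"] crossed have i: "A i \<in> H" by simp
    have "B (2 * j) \<in> H"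
      using pow2(1) crossed subgroup_cancel(1)[OF H _ Z, of "B (2 * j)"]
      by (simp add: ab_eq_N N_square) (simp add: N_def)
    with b2[of j "h div 2"] crossed have h: "B h \<in> H" by simp
    show ?case
      using a_root[of f] b_root[of j] x y crossed
      by (simp add: subgroup_cancel(1)[OF H _ h] subgroup_cancel(2)[OF H _ i])
  qed
  then show "a \<in> H" "b \<in> H" by simp_all
qed

text \<open>If x and y are both even, then 2qx and 2qy are multiples of 4q. If both are odd, the
  square is already a power of z, and its q-th power is trivial since kq and lq are even.\<close>

lemma order_same_parity:
  assumes "even x \<longleftrightarrow> even y"
  shows "N x y t [^] (2 * q) = \<one>"
proof -
  have "N x y t [^] (2 * q) = (N x y t [^] (2::int)) [^] q"
    by (simp add: int_pow_pow)
  also have "\<dots> = N (q * (x + (if even y then x else - x))) (q * ((if even x then y else - y) + y))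
      (q * twist y x)"
    unfolding N_square using assms by (intro N_even_pow) auto
  also have "\<dots> = N 0 0 0"
    using assms even_l_q even_k_q
    by (intro N_cong) (auto simp: twist_def cong_0_iff algebra_simps elim!: evenE)
  finally show ?thesis by (simp add: N_0)
qed

lemma Z_eq_one_iff: "z \<noteq> \<one> \<Longrightarrow> Z t = \<one> \<longleftrightarrow> even t"
  using z_pow_even[of t] z_pow_cong[of t 1] by (cases "even t") auto

end

section \<open>The presentation\<close>

lemma word_eval_gen_word:
  "group H \<Longrightarrow> range f \<subseteq> carrier H \<Longrightarrow> word_eval H f (gen_word x) = f x"
  by (simp add: gen_word_def group.is_monoid monoid.r_one range_subsetD)

lemma word_eval_inv_word:
  assumes "group H" "range f \<subseteq> carrier H"
  shows "word_eval H f (inv_word u) = inv\<^bsub>H\<^esub> word_eval H f u"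
proof (rule group.inv_equality[symmetric, OF assms(1)])
  show "word_eval H f (inv_word u) \<otimes>\<^bsub>H\<^esub> word_eval H f u = \<one>\<^bsub>H\<^esub>"
    \<comment> \<open>With no relations, \<open>word_equiv\<close> is free cancellation, which every
      evaluation respects.\<close>
    using word_eval_equiv[OF assms, of "{}", OF _ word_equiv_inv_left[of "{}" u]]
    by (simp add: word_eval_append[OF assms])
qed (simp_all add: word_eval_closed[OF assms])

lemma word_eval_pow_word:
  assumes "group H" "range f \<subseteq> carrier H"
  shows "word_eval H f (pow_word u m) = word_eval H f u [^]\<^bsub>H\<^esub> int m"
proof -
  interpret group H by fact
  have "word_eval H f (pow_word u m) = word_eval H f u [^]\<^bsub>H\<^esub> m"
  proof (induction m)
    case (Suc m)
    have "word_eval H f (pow_word u (Suc m)) = word_eval H f u \<otimes>\<^bsub>H\<^esub> word_eval H f u [^]\<^bsub>H\<^esub> m"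
      using Suc by (simp add: pow_word_def word_eval_append[OF assms])
    then show ?case
      using nat_pow_Suc2[OF word_eval_closed[OF assms]] by simp
  qed (simp add: pow_word_def)
  then show ?thesis by (simp add: int_pow_int)
qed

lemma word_eval_pres_gen: "word_eval (presented_group R) (pres_gen R) u = word_class R u"
proof (induction u)
  case (Cons p u)
  have "inv\<^bsub>presented_group R\<^esub> pres_gen R x = word_class R [(x, False)]" for x
    by (simp add: presented_group_inv gen_word_def inv_word_def)
  with Cons show ?case
    by (cases p) (auto simp: presented_group_mult gen_word_def)
qed (simp add: presented_group_one)

text \<open>Translates the word relations into the equations of the locale by clearing inverses. One
  direction gives the relations for the generators, the other feeds the universal property.\<close>

lemma G2_relations_iff:
  fixes H :: "('a, 'm) monoid_scheme"
  assumes "group H" "range f \<subseteq> carrier H" "e \<ge> 2" "e = 2 \<Longrightarrow> k = 0 \<and> l = 0"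
  shows "G2_relations H (f Gen_a) (f Gen_b) (2 ^ (e - 2)) (int k) (int l) \<longleftrightarrow>
    (\<forall>(u, v) \<in> G2_rels e k l. word_eval H f u = word_eval H f v)"
proof -
  interpret group H by fact
  note eval = word_eval_append[OF assms(1,2)] word_eval_gen_word[OF assms(1,2)]
    word_eval_inv_word[OF assms(1,2)] word_eval_pow_word[OF assms(1,2)]
  define a b where "a = f Gen_a" and "b = f Gen_b"
  define q :: int where "q = 2 ^ (e - 2)"
  have [simp]: "a \<in> carrier H" "b \<in> carrier H" using assms(2) by (auto simp: a_def b_def)
  have e: "e = Suc (Suc (e - 2))" using assms(3) by simp
  have n: "(2 :: int) ^ e = 4 * q" by (subst e) (simp add: q_def)
  have n2: "int (2 ^ e div 2) = 2 * q" by (subst e) (simp add: q_def)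
  have odd_q: "odd q \<Longrightarrow> int k = 0 \<and> int l = 0"
    using assms(3,4) by (cases "e = 2") (auto simp: q_def)
  have inv2: "inv\<^bsub>H\<^esub> (x [^]\<^bsub>H\<^esub> (2::int)) = x [^]\<^bsub>H\<^esub> (-2::int)" if "x \<in> carrier H" for x
    using that by (simp add: int_pow_neg)
  define w where "w = a [^]\<^bsub>H\<^esub> (2 * q) \<otimes>\<^bsub>H\<^esub> b [^]\<^bsub>H\<^esub> (2 * q)"
  have [simp]: "w \<in> carrier H" by (simp add: w_def)
  have conj: "inv\<^bsub>H\<^esub> x \<otimes>\<^bsub>H\<^esub> y = u \<longleftrightarrow> y = x \<otimes>\<^bsub>H\<^esub> u"
    if "x \<in> carrier H" "y \<in> carrier H" "u \<in> carrier H" for x y u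
    using that by (metis inv_solve_left')
  have "(\<forall>(u, v) \<in> G2_rels e k l. word_eval H f u = word_eval H f v) \<longleftrightarrow>
     a [^]\<^bsub>H\<^esub> (4 * q) = \<one>\<^bsub>H\<^esub> \<and> b [^]\<^bsub>H\<^esub> (4 * q) = \<one>\<^bsub>H\<^esub> \<and>
     b [^]\<^bsub>H\<^esub> (2::int) \<otimes>\<^bsub>H\<^esub> a [^]\<^bsub>H\<^esub> (2::int) = a [^]\<^bsub>H\<^esub> (2::int) \<otimes>\<^bsub>H\<^esub> b [^]\<^bsub>H\<^esub> (2::int) \<and>
     b \<otimes>\<^bsub>H\<^esub> a = a \<otimes>\<^bsub>H\<^esub> b \<otimes>\<^bsub>H\<^esub> a [^]\<^bsub>H\<^esub> (2::int) \<otimes>\<^bsub>H\<^esub> b [^]\<^bsub>H\<^esub> (-2::int) \<otimes>\<^bsub>H\<^esub> w [^]\<^bsub>H\<^esub> int k \<and>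
     b [^]\<^bsub>H\<^esub> (2::int) \<otimes>\<^bsub>H\<^esub> a = a \<otimes>\<^bsub>H\<^esub> b [^]\<^bsub>H\<^esub> (-2::int) \<otimes>\<^bsub>H\<^esub> w [^]\<^bsub>H\<^esub> int l \<and>
     a [^]\<^bsub>H\<^esub> (2::int) \<otimes>\<^bsub>H\<^esub> b = b \<otimes>\<^bsub>H\<^esub> a [^]\<^bsub>H\<^esub> (-2::int) \<otimes>\<^bsub>H\<^esub> w [^]\<^bsub>H\<^esub> int l"
    unfolding G2_rels_def Let_def comm_word_def conj_word_def
    by (simp add: eval a_def[symmetric] b_def[symmetric] n n2 w_def[symmetric] conj m_assoc
        del: of_nat_div) (simp add: inv2)
  also have "\<dots> \<longleftrightarrow> G2_relations H a b q (int k) (int l)"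
    using odd_q by (simp add: G2_relations_def G2_relations_axioms_def w_def is_group)
  finally show ?thesis by (simp add: a_def b_def q_def)
qed

section \<open>An action on the integers modulo \<open>4q\<close>\<close>

text \<open>
  Left multiplication on the cosets \<open>a\<^sup>x \<langle>b\<rangle>\<close>: the generator \<open>a\<close> acts by \<open>x \<mapsto> x + 1\<close>, and \<open>b\<close>
  by \<open>mirror\<close>, which is \<open>x \<mapsto> - x\<close> corrected by \<open>2q\<close> times the exponent of \<open>z\<close> in \<open>b a\<^sup>x\<close>.
  The maps act on representatives in \<open>int\<close>, and are invertible only modulo \<open>4q\<close>.
\<close>

locale circle_action =
  fixes q k l :: int
  assumes odd_q: "odd q \<Longrightarrow> k = 0 \<and> l = 0"
begin

definition same :: "int \<Rightarrow> int \<Rightarrow> bool" (infix \<open>\<doteq>\<close> 50) where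
  "x \<doteq> y \<longleftrightarrow> [x = y] (mod 4 * q)"

lemma same_refl [simp]: "x \<doteq> x"
  and same_sym: "x \<doteq> y \<Longrightarrow> y \<doteq> x"
  and same_trans [trans]: "x \<doteq> y \<Longrightarrow> y \<doteq> t \<Longrightarrow> x \<doteq> t"
  and same_add: "x \<doteq> y \<Longrightarrow> x + t \<doteq> y + t"
  by (auto simp: same_def cong_sym intro: cong_trans cong_add)

text \<open>The quotient is x/2 for even x and (x + 1)/2 for odd x, so one formula covers both
  parities of \<open>twist\<close> at y = 1.\<close>

definition mirror :: "int \<Rightarrow> int" where
  "mirror x = - x + 2 * q * (l * ((x + 1) div 2) + (if odd x then k else 0))"

text \<open>By \<open>mirror_mirror\<close>, applying \<open>mirror\<close> twice shifts odd points
  by 2ql; the correction for the inverse letter of b undoes this modulo 4q.\<close>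

fun letter :: "gen \<times> bool \<Rightarrow> int \<Rightarrow> int" where
  "letter (Gen_a, s) x = (if s then x + 1 else x - 1)"
| "letter (Gen_b, s) x = mirror x + (if s \<or> even x then 0 else 2 * q * l)"

abbreviation act :: "gen word \<Rightarrow> int \<Rightarrow> int" where
  "act w x \<equiv> foldr letter w x"

lemma same_period [simp]: "x + 4 * q \<doteq> x"
  by (simp add: same_def cong_iff_dvd_diff)

text \<open>The second summand is also a multiple of 4q, since lq is even.\<close>

lemma sameI:
  assumes "x - y = 4 * q * r + 2 * q * (l * q) * t"
  shows "x \<doteq> y"
proof -
  obtain w where w: "l * q = 2 * w"
    using odd_q by (cases "even q") (auto elim!: evenE)
  have "x - y = 4 * q * (r + w * t)"
    unfolding assms w by (simp add: algebra_simps)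
  then show ?thesis by (simp add: same_def cong_iff_dvd_diff)
qed

lemma same_diff: "x \<doteq> y \<Longrightarrow> x - t \<doteq> y - t"
  using same_add[of x y "- t"] by simp

lemma mirror_even: "mirror (2 * s) = - (2 * s) + 2 * q * (l * s)"
  and mirror_odd: "mirror (2 * s + 1) = - (2 * s + 1) + 2 * q * (l * (s + 1) + k)"
  by (simp_all add: mirror_def)

lemma letter_cong:
  assumes "x \<doteq> y" shows "letter p x \<doteq> letter p y"
proof -
  obtain r where "x - y = 4 * q * r"
    using assms by (auto simp: same_def cong_iff_dvd_diff dvd_def)
  then have x: "x = y + 2 * (2 * q * r)" by simp
  then have "(x + 1) div 2 = (y + 1) div 2 + 2 * q * r" and "even x \<longleftrightarrow> even y"
    by simp_all
  then have "mirror x - mirror y = 4 * q * (- r) + 2 * q * (l * q) * (2 * r)"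
    unfolding mirror_def by (simp add: x algebra_simps)
  then have "mirror x \<doteq> mirror y" by (rule sameI)
  with assms \<open>even x \<longleftrightarrow> even y\<close> show ?thesis
    by (cases "(p, x)" rule: letter.cases) (auto intro: same_add same_diff)
qed

lemma act_cong: "x \<doteq> y \<Longrightarrow> act w x \<doteq> act w y"
  by (induction w) (auto intro: letter_cong)

text \<open>Mirrors b^2 a^x = a^x b^-2 z^l for odd x, where z shifts cosets by 2q, and b^2 a^x = a^x
  b^2 for even x.\<close>

lemma mirror_mirror: "mirror (mirror x) \<doteq> x + (if odd x then 2 * q * l else 0)"
proof (cases "even x")
  case True
  then obtain s where x: "x = 2 * s" by blast
  have m: "mirror x = 2 * (- s + q * (l * s))"
    by (simp add: x mirror_even)
  have "mirror (mirror x) - x = 4 * q * (- l * s) + 2 * q * (l * q) * (l * s)"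
    unfolding m unfolding mirror_even x by (simp add: algebra_simps)
  from sameI[OF this] True show ?thesis by simp
next
  case False
  then obtain s where x: "x = 2 * s + 1" by (blast elim: oddE)
  have m: "mirror x = 2 * (- s - 1 + q * (l * (s + 1) + k)) + 1"
    by (simp add: x mirror_odd)
  have "mirror (mirror x) - (x + 2 * q * l)
      = 4 * q * (- l * (s + 1)) + 2 * q * (l * q) * (l * (s + 1) + k)"
    unfolding m unfolding mirror_odd x by (simp add: algebra_simps)
  from sameI[OF this] False show ?thesis by simp
qed

lemma even_mirror [simp]: "even (mirror x) \<longleftrightarrow> even x"
  by (simp add: mirror_def)

lemma letter_cancel: "letter (g, s) (letter (g, \<not> s) x) \<doteq> x"
proof (cases g)
  case Gen_b
  show ?thesis
  proof (cases "even x")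
    case True
    then show ?thesis using Gen_b mirror_mirror[of x] by simp
  next
    case False
    have "mirror (mirror x) + 2 * q * l \<doteq> x + 2 * q * l + 2 * q * l"
      using same_add[OF mirror_mirror[of x], of "2 * q * l"] False by (simp only: if_True not_False_eq_True)
    also have "x + 2 * q * l + 2 * q * l \<doteq> x" by (simp add: same_def cong_iff_dvd_diff)
    finally have 1: "mirror (mirror x) + 2 * q * l \<doteq> x" .
    obtain s where x: "x = 2 * s + 1" using False by (blast elim: oddE)
    have m: "mirror x + 2 * q * l = 2 * (- s - 1 + q * (l * (s + 2) + k)) + 1"
      unfolding x mirror_odd by (simp add: algebra_simps)
    have "mirror (mirror x + 2 * q * l) - x
        = 4 * q * (- l * (s + 1)) + 2 * q * (l * q) * (l * (s + 2) + k)"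
      unfolding m unfolding mirror_odd x by (simp add: algebra_simps)
    then have "mirror (mirror x + 2 * q * l) \<doteq> x" by (rule sameI)
    then show ?thesis using 1 Gen_b False by auto
  qed
qed simp

text \<open>The letters are invertible only modulo 4q, so instead of evaluating words in a
  permutation group the proof is an induction on \<open>word_equiv\<close>.\<close>

lemma word_equiv_act:
  assumes "\<And>u v x. (u, v) \<in> R \<Longrightarrow> act u x \<doteq> act v x" and "word_equiv R u v"
  shows "act u x \<doteq> act v x"
  using assms(2)
proof (induction arbitrary: x)
  case (sym u v)
  show ?case by (rule same_sym) (rule sym.IH)
next
  case (trans u v w)
  show ?case by (rule same_trans) (rule trans.IH)+
next
  case (mult u u' v v')
  have "act u (act v x) \<doteq> act u (act v' x)" by (rule act_cong) (rule mult.IH)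
  also have "act u (act v' x) \<doteq> act u' (act v' x)" by (rule mult.IH)
  finally show ?case by simp
next
  case (cancel y s)
  show ?case using letter_cancel by simp
next
  case (rel u v)
  then show ?case by (rule assms(1))
qed simp

lemma act_inv_word: "y \<doteq> act w x \<Longrightarrow> act (inv_word w) y \<doteq> x"
  using word_equiv_act[of "{}" "inv_word w @ w" "[]" x] word_equiv_inv_left[of "{}" w]
    act_cong[of y "act w x" "inv_word w"]
  by (auto intro: same_trans)

lemma act_pow_word_shift:
  assumes "\<And>x. act w x \<doteq> x + d"
  shows "act (pow_word w m) x \<doteq> x + int m * d"
proof (induction m)
  case (Suc m)
  have "act (pow_word w (Suc m)) x = act w (act (pow_word w m) x)"
    by (simp add: pow_word_def)
  also have "\<dots> \<doteq> act w (x + int m * d)" by (rule act_cong) (rule Suc)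
  also have "act w (x + int m * d) \<doteq> (x + int m * d) + d" by (rule assms)
  finally show ?case by (simp add: algebra_simps)
qed (simp add: pow_word_def)

section \<open>The action respects the defining relations\<close>

abbreviation "wa \<equiv> gen_word Gen_a"
abbreviation "wb \<equiv> gen_word Gen_b"

lemma act_a [simp]: "act wa x = x + 1" and act_b [simp]: "act wb x = mirror x"
  and act_inv_a [simp]: "act (inv_word wa) x = x - 1"
  by (simp_all add: gen_word_def inv_word_def)

lemma act_pow_a: "act (pow_word wa m) x = x + int m"
  by (induction m) (simp_all add: pow_word_def)

lemma act_b2: "act (pow_word wb 2) x \<doteq> x + (if odd x then 2 * q * l else 0)"
  using mirror_mirror[of x] by (simp add: pow_word_def numeral_2_eq_2)

lemma act_inv_b2: "act (inv_word (pow_word wb 2)) x \<doteq> x + (if odd x then 2 * q * l else 0)"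
proof (rule act_inv_word, rule same_sym)
  let ?y = "x + (if odd x then 2 * q * l else 0)"
  have "act (pow_word wb 2) ?y \<doteq> ?y + (if odd ?y then 2 * q * l else 0)"
    by (rule act_b2)
  also have "\<dots> \<doteq> x" by (auto simp: same_def cong_iff_dvd_diff)
  finally show "act (pow_word wb 2) ?y \<doteq> x" .
qed

lemma pow_word_mult: "pow_word w (m * n) = pow_word (pow_word w m) n"
  by (induction n) (simp_all add: pow_word_def replicate_add)

text \<open>b^2 acts as a shift by 2ql on odd points, so b^4 acts trivially, and b^2 does if l =
  0.\<close>

lemma act_pow_b: "even m \<or> l = 0 \<Longrightarrow> act (pow_word wb (2 * m)) x \<doteq> x"
proof -
  have *: "act (pow_word (pow_word wb 2) 2) x \<doteq> x + 0" for x
  proof -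
    have "act (pow_word (pow_word wb 2) 2) x = act (pow_word wb 2) (act (pow_word wb 2) x)"
      by (simp add: pow_word_def numeral_2_eq_2)
    also have "\<dots> \<doteq> act (pow_word wb 2) (x + (if odd x then 2 * q * l else 0))"
      by (rule act_cong) (rule act_b2)
    also have "\<dots> \<doteq> x + (if odd x then 2 * q * l else 0) + (if odd x then 2 * q * l else 0)"
      using act_b2[of "x + (if odd x then 2 * q * l else 0)"] by (cases "odd x") (simp_all add: add.assoc)
    also have "\<dots> \<doteq> x + 0" by (auto simp: same_def cong_iff_dvd_diff)
    finally show ?thesis .
  qed
  assume "even m \<or> l = 0"
  then show ?thesis
  proof
    assume "even m"
    then obtain r where "m = 2 * r" by blast
    then have "pow_word wb (2 * m) = pow_word (pow_word (pow_word wb 2) 2) r"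
      by (simp only: pow_word_mult)
    then show ?thesis
      using act_pow_word_shift[OF *, of r x] by simp
  next
    assume "l = 0"
    then have "act (pow_word wb 2) x \<doteq> x + 0" for x
      using act_b2[of x] by (cases "odd x") simp_all
    from act_pow_word_shift[OF this, of m x] show ?thesis by (simp add: pow_word_mult)
  qed
qed

definition "wz = pow_word wa (2 * nat q) @ pow_word wb (2 * nat q)"

text \<open>By \<open>odd_q\<close>, b^(2q) acts trivially, so z acts as the translation by
  2q.\<close>

lemma act_z_pow:
  assumes "q \<ge> 0"
  shows "act (pow_word wz m) x \<doteq> x + 2 * q * int m"
proof -
  have "act wz x \<doteq> x + 2 * q" for x
    using same_add[OF act_pow_b[of "nat q" x], of "2 * q"] odd_q assms
    by (auto simp: wz_def act_pow_a even_nat_iff)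
  from act_pow_word_shift[OF this, of m x] show ?thesis
    by (simp add: algebra_simps)
qed

text \<open>Moves the inverses to the other side, so that only uv and vur need to be
  compared.\<close>

lemma act_comm_word: "act (u @ v) x \<doteq> act (v @ u @ r) x \<Longrightarrow> act (comm_word u v) x \<doteq> act r x"
  unfolding comm_word_def foldr_append o_apply by (intro act_inv_word)

lemma act_conj_word: "act (u @ v) x \<doteq> act (v @ r) x \<Longrightarrow> act (conj_word u v) x \<doteq> act r x"
  unfolding conj_word_def foldr_append o_apply by (intro act_inv_word)

lemma act_G2_rels:
  assumes "e \<ge> 2" "q = 2 ^ (e - 2)" and kl: "int k' = k" "int l' = l"
    and uv: "(u, v) \<in> G2_rels e k' l'"
  shows "act u x \<doteq> act v x"
proof -
  have e: "e = Suc (Suc (e - 2))" using assms(1) by simp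
  have q: "q \<ge> 0" using assms(2) by simp
  have n: "(2 :: nat) ^ e = 4 * nat q" by (subst e) (simp add: assms(2) nat_power_eq)
  have b4: "act (pow_word wb (4 * nat q)) x \<doteq> x"
    using act_pow_b[of "2 * nat q" x] by simp
  have squares: "act (pow_word wb 2 @ pow_word wa 2) x \<doteq> act (pow_word wa 2 @ pow_word wb 2 @ []) x"
  proof -
    have "act (pow_word wb 2) (x + 2) \<doteq> x + (if odd x then 2 * q * l else 0) + 2"
      using act_b2[of "x + 2"] by (simp add: algebra_simps)
    then show ?thesis
      using same_trans[OF _ same_sym[OF same_add[OF act_b2[of x], of 2]]] by (simp add: act_pow_a)
  qed
  have ba: "act (wb @ wa) x \<doteq> act (wa @ wb @ pow_word wa 2 @ inv_word (pow_word wb 2) @ pow_word wz k') x"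
  proof -
    have "act (inv_word (pow_word wb 2)) (act (pow_word wz k') x)
      \<doteq> act (inv_word (pow_word wb 2)) (x + 2 * q * k)"
      by (rule act_cong) (rule act_z_pow[OF q, of k', unfolded kl])
    also have "\<dots> \<doteq> x + 2 * q * k + (if odd x then 2 * q * l else 0)"
      using act_inv_b2[of "x + 2 * q * k"] by simp
    finally have "act (wa @ wb @ pow_word wa 2) (act (inv_word (pow_word wb 2)) (act (pow_word wz k') x))
      \<doteq> act (wa @ wb @ pow_word wa 2) (x + 2 * q * k + (if odd x then 2 * q * l else 0))"
      by (rule act_cong)
    \<comment> \<open>With z^k and b^-2 evaluated, the relation is a congruence between two values
      of \<open>mirror\<close>, checked for each parity of x.\<close>
    moreover have "mirror (x + 1)
      \<doteq> act (wa @ wb @ pow_word wa 2) (x + 2 * q * k + (if odd x then 2 * q * l else 0))"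
    proof (cases "even x")
      case True
      then obtain s where x: "x = 2 * s" by blast
      have "act (wa @ wb @ pow_word wa 2) (x + 2 * q * k + (if odd x then 2 * q * l else 0))
        = mirror (2 * (s + 1 + q * k)) + 1"
        by (simp add: x act_pow_a algebra_simps)
      moreover have "mirror (2 * s + 1) - (mirror (2 * (s + 1 + q * k)) + 1) = 4 * q * k + 2 * q * (l * q) * - k"
        unfolding mirror_even mirror_odd by (simp add: algebra_simps)
      ultimately show ?thesis
        unfolding x using sameI by (metis add.assoc one_add_one mult_2 distrib_left mult.right_neutral)
    next
      case False
      then obtain s where x: "x = 2 * s + 1" by (blast elim: oddE)
      have "act (wa @ wb @ pow_word wa 2) (x + 2 * q * k + (if odd x then 2 * q * l else 0))
        = mirror (2 * (s + 1 + q * k + q * l) + 1) + 1"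
        by (simp add: x act_pow_a algebra_simps)
      moreover have "mirror (2 * (s + 1)) - (mirror (2 * (s + 1 + q * k + q * l) + 1) + 1)
          = 4 * q * 0 + 2 * q * (l * q) * - (k + l)"
        unfolding mirror_even mirror_odd by (simp add: algebra_simps)
      ultimately show ?thesis
        unfolding x using sameI by (metis add.assoc one_add_one mult_2 distrib_left mult.right_neutral)
    qed
    ultimately show ?thesis by (auto intro: same_trans same_sym)
  qed
  have b2a: "act (pow_word wb 2 @ wa) x \<doteq> act (wa @ inv_word (pow_word wb 2) @ pow_word wz l') x"
  proof -
    have "act (inv_word (pow_word wb 2)) (act (pow_word wz l') x)
      \<doteq> act (inv_word (pow_word wb 2)) (x + 2 * q * l)"
      by (rule act_cong) (rule act_z_pow[OF q, of l', unfolded kl])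
    also have "\<dots> \<doteq> x + 2 * q * l + (if odd x then 2 * q * l else 0)"
      using act_inv_b2[of "x + 2 * q * l"] by simp
    finally have "act wa (act (inv_word (pow_word wb 2)) (act (pow_word wz l') x))
      \<doteq> act wa (x + 2 * q * l + (if odd x then 2 * q * l else 0))"
      by (rule act_cong)
    moreover have "act wa (x + 2 * q * l + (if odd x then 2 * q * l else 0))
      \<doteq> x + 1 + (if odd (x + 1) then 2 * q * l else 0)"
      by (auto simp: same_def cong_iff_dvd_diff)
    ultimately show ?thesis
      using act_b2[of "x + 1"] by simp (meson same_trans same_sym)
  qed
  have a2b: "act (pow_word wa 2 @ wb) x \<doteq> act (wb @ inv_word (pow_word wa 2) @ pow_word wz l') x"
  proof -
    have "act (wb @ inv_word (pow_word wa 2)) (act (pow_word wz l') x)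
      \<doteq> act (wb @ inv_word (pow_word wa 2)) (x + 2 * q * l)"
      by (rule act_cong) (rule act_z_pow[OF q, of l', unfolded kl])
    moreover have "inv_word (pow_word wa 2) = [(Gen_a, False), (Gen_a, False)]"
      by (simp add: gen_word_def inv_word_def pow_word_def numeral_2_eq_2)
    moreover have "mirror x + 2 \<doteq> mirror (x + 2 * q * l - 2)"
    proof (cases "even x")
      case True
      then obtain s where x: "x = 2 * s" by blast
      have m: "x + 2 * q * l - 2 = 2 * (s + q * l - 1)"
        by (simp add: x)
      have "mirror x + 2 - mirror (x + 2 * q * l - 2) = 4 * q * l + 2 * q * (l * q) * - l"
        unfolding m unfolding mirror_even x by (simp add: algebra_simps)
      then show ?thesis by (rule sameI)
    next
      case False
      then obtain s where x: "x = 2 * s + 1" by (blast elim: oddE)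
      have m: "x + 2 * q * l - 2 = 2 * (s + q * l - 1) + 1"
        by (simp add: x)
      have "mirror x + 2 - mirror (x + 2 * q * l - 2) = 4 * q * l + 2 * q * (l * q) * - l"
        unfolding m unfolding mirror_odd x by (simp add: algebra_simps)
      then show ?thesis by (rule sameI)
    qed
    ultimately show ?thesis
      by (auto simp: act_pow_a intro: same_trans same_sym)
  qed
  from uv show ?thesis
    unfolding G2_rels_def Let_def n
    using b4 q act_comm_word[OF squares] act_comm_word[OF ba] act_conj_word[OF b2a] act_conj_word[OF a2b]
    by (auto simp: act_pow_a wz_def)
qed

text \<open>Both words send 0 to 2q, which is nonzero modulo 4q.\<close>

lemma nontrivial_words:
  fixes e k' l' :: nat
  assumes "e \<ge> 2" "q = 2 ^ (e - 2)" "int k' = k" "int l' = l"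
  shows "\<not> word_equiv (G2_rels e k' l') (pow_word wa (2 * nat q)) []"
    and "\<not> word_equiv (G2_rels e k' l') wz []"
proof -
  have *: "\<not> word_equiv (G2_rels e k' l') u []" if "act u 0 \<doteq> 2 * q" for u
  proof
    assume "word_equiv (G2_rels e k' l') u []"
    then have "act u 0 \<doteq> act [] 0"
      by (rule word_equiv_act[rotated]) (rule act_G2_rels[OF assms])
    then have "2 * q \<doteq> 0"
      using same_trans[OF same_sym[OF that]] by simp
    then have "4 * q dvd 2 * q" by (simp only: same_def cong_0_iff)
    moreover have "q > 0" using assms(2) by simp
    ultimately show False using zdvd_imp_le[of "4 * q" "2 * q"] by simp
  qed
  have q: "q \<ge> 0" using assms(2) by simp
  show "\<not> word_equiv (G2_rels e k' l') (pow_word wa (2 * nat q)) []"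
    by (rule *) (simp add: act_pow_a q)
  show "\<not> word_equiv (G2_rels e k' l') wz []"
    using act_z_pow[OF q, of 1 0] by (intro *) (simp add: pow_word_def)
qed

end

section \<open>Automorphisms\<close>

locale G2_presentation =
  fixes e k l :: nat
  assumes e_ge_2: "e \<ge> 2" and small: "e = 2 \<Longrightarrow> k = 0 \<and> l = 0"
begin

abbreviation "G \<equiv> G2 e k l"
abbreviation "a \<equiv> G2_a e k l"
abbreviation "b \<equiv> G2_b e k l"
abbreviation q :: int where "q \<equiv> 2 ^ (e - 2)"

lemma odd_q: "odd q \<Longrightarrow> int k = 0 \<and> int l = 0"
  using e_ge_2 small by (cases "e = 2") auto

sublocale G2_relations G a b q "int k" "int l"
proof -
  have "range (pres_gen (G2_rels e k l)) \<subseteq> carrier (presented_group (G2_rels e k l))"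
    by (auto simp: word_class_in_carrier)
  from G2_relations_iff[OF group_presented_group this e_ge_2 small]
  show "G2_relations G a b q (int k) (int l)"
    by (auto simp: G2_def G2_a_def G2_b_def word_eval_pres_gen presented_group_rel)
qed

section \<open>Homomorphisms and normal forms in the presented group\<close>

lemma hom_exists:
  assumes "G2_relations H x y q (int k) (int l)"
  shows "\<exists>\<phi>\<in>hom G H. \<phi> a = x \<and> \<phi> b = y"
proof -
  interpret H: G2_relations H x y q "int k" "int l" by fact
  define f where "f g = (case g of Gen_a \<Rightarrow> x | Gen_b \<Rightarrow> y)" for g
  have f: "range f \<subseteq> carrier H"
    by (auto simp: f_def split: gen.split)
  have "G2_relations H (f Gen_a) (f Gen_b) q (int k) (int l)"
    using assms by (simp add: f_def)
  then have "\<forall>(u, v) \<in> G2_rels e k l. word_eval H f u = word_eval H f v"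
    using G2_relations_iff[OF H.is_group f e_ge_2 small] by blast
  then have "\<exists>\<phi>\<in>hom (presented_group (G2_rels e k l)) H. \<forall>g. \<phi> (pres_gen (G2_rels e k l) g) = f g"
    by (intro presented_group_universal[OF H.is_group f]) auto
  then obtain \<phi> where "\<phi> \<in> hom G H" "\<And>g. \<phi> (pres_gen (G2_rels e k l) g) = f g"
    unfolding G2_def by blast
  then show ?thesis
    by (intro bexI[of _ \<phi>]) (simp_all add: G2_a_def G2_b_def f_def)
qed

text \<open>Generators and their inverses are normal forms, and \<open>N_mult\<close> closes normal
  forms under products.\<close>

lemma carrier_normal_form: "g \<in> carrier G \<Longrightarrow> \<exists>x y t. g = N x y t"
proof -
  assume "g \<in> carrier G"
  then obtain u where "g = word_class (G2_rels e k l) u"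
    by (auto simp: G2_def presented_group_carrier)
  then have g: "g = word_eval G (pres_gen (G2_rels e k l)) u"
    by (simp add: G2_def word_eval_pres_gen)
  have letter: "\<exists>x y t. (if s then pres_gen (G2_rels e k l) c else inv\<^bsub>G\<^esub> pres_gen (G2_rels e k l) c) = N x y t"
    for c s
  proof (cases c)
    case Gen_a
    have "a = N 1 0 0" "inv\<^bsub>G\<^esub> a = N (- 1) 0 0"
      using int_pow_neg[of a 1] by (simp_all add: N_def)
    with Gen_a show ?thesis unfolding G2_a_def by metis
  next
    case Gen_b
    have "b = N 0 1 0" "inv\<^bsub>G\<^esub> b = N 0 (- 1) 0"
      using int_pow_neg[of b 1] by (simp_all add: N_def)
    with Gen_b show ?thesis unfolding G2_b_def by metis
  qed
  have "\<exists>x y t. word_eval G (pres_gen (G2_rels e k l)) u = N x y t"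
  proof (induction u)
    case Nil
    show ?case using N_0 by (metis word_eval.simps(1))
  next
    case (Cons p u)
    obtain c s where p: "p = (c, s)" by force
    from letter[of s c] Cons obtain x y t x' y' t' where
      "(if s then pres_gen (G2_rels e k l) c else inv\<^bsub>G\<^esub> pres_gen (G2_rels e k l) c) = N x y t"
      "word_eval G (pres_gen (G2_rels e k l)) u = N x' y' t'" by blast
    then show ?case
      unfolding p word_eval.simps by (auto simp: N_mult)
  qed
  with g show ?thesis by simp
qed

lemma carrier_ab: "g \<in> carrier G \<Longrightarrow> \<exists>x y. g = A x \<otimes>\<^bsub>G\<^esub> B y"
  using carrier_normal_form N_eq_ab by metis

lemma finite_carrier: "finite (carrier G)"
  using carrier_normal_form by (intro finite_subset[OF _ finite_N]) auto

lemma subgroup_full: "subgroup H G \<Longrightarrow> a \<in> H \<Longrightarrow> b \<in> H \<Longrightarrow> g \<in> carrier G \<Longrightarrow> g \<in> H"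
  by (auto dest!: carrier_ab intro!: subgroup.m_closed subgroup_int_pow_closed)

section \<open>Nontrivial elements and parity homomorphisms\<close>

lemma a_pow_neq_one: "A (2 * q) \<noteq> \<one>\<^bsub>G\<^esub>" and z_neq_one: "z \<noteq> \<one>\<^bsub>G\<^esub>"
proof -
  interpret circle: circle_action q "int k" "int l"
    using odd_q by unfold_locales
  let ?R = "G2_rels e k l"
  have gens: "group G" "range (pres_gen ?R) \<subseteq> carrier G"
    by (auto simp: G2_def word_class_in_carrier group_presented_group)
  have trivial: "word_eval G (pres_gen ?R) u = \<one>\<^bsub>G\<^esub> \<longleftrightarrow> word_equiv ?R u []" for u
    by (simp add: G2_def word_eval_pres_gen presented_group_one word_class_eq_iff)
  note eval = word_eval_append[OF gens] word_eval_pow_word[OF gens] word_eval_gen_word[OF gens]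
  show "A (2 * q) \<noteq> \<one>\<^bsub>G\<^esub>"
    using circle.nontrivial_words(1)[OF e_ge_2 HOL.refl HOL.refl HOL.refl]
    by (simp add: trivial[symmetric] eval G2_a_def[symmetric])
  show "z \<noteq> \<one>\<^bsub>G\<^esub>"
    using circle.nontrivial_words(2)[OF e_ge_2 HOL.refl HOL.refl HOL.refl]
    by (simp add: trivial[symmetric] circle.wz_def eval G2_a_def[symmetric] G2_b_def[symmetric] z_def)
qed

lemma b_pow_neq_one: "B (2 * q) \<noteq> \<one>\<^bsub>G\<^esub>"
proof
  \<comment> \<open>In the action \<open>b\<^sup>4\<close> is trivial, so the claim is transported along the swap of \<open>a\<close> and \<open>b\<close>.\<close>
  have "G2_relations G (A 0 \<otimes>\<^bsub>G\<^esub> B 1) (A 1 \<otimes>\<^bsub>G\<^esub> B 0) q (int k) (int l)"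
    by (rule images_relations) (simp_all add: exponent_parity_def)
  then have "G2_relations G b a q (int k) (int l)" by simp
  from hom_exists[OF this] obtain \<phi> where \<phi>: "\<phi> \<in> hom G G" "\<phi> a = b" "\<phi> b = a" by blast
  assume "B (2 * q) = \<one>\<^bsub>G\<^esub>"
  then have "\<phi> (B (2 * q)) = \<one>\<^bsub>G\<^esub>"
    using hom_one[OF \<phi>(1) is_group is_group] by simp
  then have "A (2 * q) = \<one>\<^bsub>G\<^esub>"
    using hom_int_pow[OF \<phi>(1) b_closed is_group is_group] \<phi>(3) by simp
  with a_pow_neq_one show False by simp
qed

text \<open>All relations hold modulo 2 in an abelian group, so the parities of the exponents of a
  and of b are well defined on the group.\<close>

lemma parity_hom:
  assumes "c \<in> {0, 1}" "d \<in> {0, 1}"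
  shows "\<exists>\<chi>\<in>hom G (integer_mod_group 2). \<forall>x y. \<chi> (A x \<otimes>\<^bsub>G\<^esub> B y) = (x * c + y * d) mod 2"
proof -
  let ?M = "integer_mod_group 2"
  have cd: "c \<in> carrier ?M" "d \<in> carrier ?M"
    using assms by (auto simp: carrier_integer_mod_group)
  note calc = int_pow_integer_mod_group mult_integer_mod_group one_integer_mod_group
  have "G2_relations ?M c d q (int k) (int l)"
    using cd odd_q
    by (simp add: G2_relations_def G2_relations_axioms_def calc mod_simps algebra_simps)
  from hom_exists[OF this] obtain \<chi> where \<chi>: "\<chi> \<in> hom G ?M" "\<chi> a = c" "\<chi> b = d" by blast
  have "\<chi> (A x \<otimes>\<^bsub>G\<^esub> B y) = (x * c + y * d) mod 2" for x y
    using hom_mult[OF \<chi>(1), of "A x" "B y"] hom_int_pow[OF \<chi>(1) _ is_group group_integer_mod_group]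
    by (simp add: \<chi> calc mod_simps mult.commute)
  with \<chi>(1) show ?thesis by blast
qed

text \<open>Finiteness gives injectivity. The restriction is taken because members of
  \<open>auto G\<close> are extensional on the carrier.\<close>

lemma surjective_endo_auto:
  assumes "\<phi> \<in> hom G G" "a \<in> \<phi> ` carrier G" "b \<in> \<phi> ` carrier G"
  shows "restrict \<phi> (carrier G) \<in> auto G"
proof -
  interpret \<phi>: group_hom G G \<phi>
    using assms(1) by unfold_locales
  have "\<phi> ` carrier G = carrier G"
    using subgroup_full[OF \<phi>.img_is_subgroup] assms(2,3) \<phi>.hom_closed by blast
  then have "bij_betw \<phi> (carrier G) (carrier G)"
    using finite_carrier by (simp add: bij_betw_def eq_card_imp_inj_on)
  then have "bij_betw (restrict \<phi> (carrier G)) (carrier G) (carrier G)"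
    by (simp add: bij_betw_restrict_eq)
  moreover have "restrict \<phi> (carrier G) \<in> hom G G"
    by (rule homI) simp_all
  ultimately show ?thesis
    by (simp add: auto_def Bij_def)
qed

lemma hom_eqI:
  assumes "\<phi> \<in> hom G G" "\<psi> \<in> hom G G" "\<phi> a = \<psi> a" "\<phi> b = \<psi> b" "g \<in> carrier G"
  shows "\<phi> g = \<psi> g"
proof -
  interpret \<phi>: group_hom G G \<phi> using assms(1) by unfold_locales
  interpret \<psi>: group_hom G G \<psi> using assms(2) by unfold_locales
  from carrier_ab[OF assms(5)] obtain x y where "g = A x \<otimes>\<^bsub>G\<^esub> B y" by blast
  then show ?thesis
    using assms(3,4) by (simp add: \<phi>.hom_int_pow \<psi>.hom_int_pow)
qed

text \<open>z has order exactly 2, so for l = 1 the equation says that half of i + j - f - h is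
  even.\<close>

lemma aut_exponents_iff:
  assumes "l \<in> {0, 1}"
  shows "aut_exponents l i j f h \<longleftrightarrow>
    exponent_parity i j f h \<and> Z (int l * ((i + j - f - h) div 2)) = \<one>\<^bsub>G\<^esub>"
proof (cases "exponent_parity i j f h")
  case True
  then have "even (i + j - f - h)" by (auto simp: exponent_parity_def)
  then have "even ((i + j - f - h) div 2) \<longleftrightarrow> 4 dvd (i + j - f - h)" by presburger
  also have "\<dots> \<longleftrightarrow> [i + j = f + h] (mod 4)"
    by (simp add: cong_iff_dvd_diff algebra_simps)
  finally show ?thesis
    using assms True z_neq_one unfolding aut_exponents_def exponent_parity_def
    by (auto simp: Z_eq_one_iff)
next
  case False
  then show ?thesis
    unfolding aut_exponents_def exponent_parity_def by blast
qed

section \<open>Existence and shape of the automorphisms\<close>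

lemma aut_exists:
  assumes "exponent_parity i j f h" "Z (int l * ((i + j - f - h) div 2)) = \<one>\<^bsub>G\<^esub>"
  shows "\<exists>\<sigma>\<in>auto G. \<sigma> a = A i \<otimes>\<^bsub>G\<^esub> B j \<and> \<sigma> b = A f \<otimes>\<^bsub>G\<^esub> B h"
proof -
  let ?x = "A i \<otimes>\<^bsub>G\<^esub> B j" and ?y = "A f \<otimes>\<^bsub>G\<^esub> B h"
  obtain \<phi> where \<phi>: "\<phi> \<in> hom G G" "\<phi> a = ?x" "\<phi> b = ?y"
    using hom_exists[OF images_relations[OF assms]] by blast
  interpret \<phi>: group_hom G G \<phi> using \<phi>(1) by unfold_locales
  \<comment> \<open>\<open>other_relations\<close> contains x^(2q) y^(2q) = z, which puts z into the
    image, as \<open>images_generate\<close> requires.\<close>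
  have "\<phi> z = z"
    using images(1)[OF assms(1)] unfolding other_relations_def
    by (simp add: z_def \<phi>.hom_int_pow \<phi>)
  then have "z \<in> \<phi> ` carrier G"
    by (metis image_eqI z_closed)
  moreover have "?x \<in> \<phi> ` carrier G" "?y \<in> \<phi> ` carrier G"
    using \<phi> by (metis image_eqI a_closed, metis image_eqI b_closed)
  ultimately have "a \<in> \<phi> ` carrier G" "b \<in> \<phi> ` carrier G"
    using images_generate[OF assms(1) HOL.refl \<phi>.img_is_subgroup] by blast+
  then have "restrict \<phi> (carrier G) \<in> auto G"
    by (rule surjective_endo_auto[OF \<phi>(1)])
  then show ?thesis
    using \<phi> by (intro bexI[of _ "restrict \<phi> (carrier G)"]) simp_all
qed

lemma aut_form:
  assumes "\<sigma> \<in> auto G"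
  shows "\<exists>i j f h. exponent_parity i j f h \<and> Z (int l * ((i + j - f - h) div 2)) = \<one>\<^bsub>G\<^esub> \<and>
    \<sigma> a = A i \<otimes>\<^bsub>G\<^esub> B j \<and> \<sigma> b = A f \<otimes>\<^bsub>G\<^esub> B h"
proof -
  have hom: "\<sigma> \<in> hom G G" and bij: "bij_betw \<sigma> (carrier G) (carrier G)"
    using assms by (auto simp: auto_def Bij_def)
  interpret \<sigma>: group_hom G G \<sigma> using hom by unfold_locales
  obtain i j where x: "\<sigma> a = A i \<otimes>\<^bsub>G\<^esub> B j" using carrier_ab[of "\<sigma> a"] by auto
  obtain f h where y: "\<sigma> b = A f \<otimes>\<^bsub>G\<^esub> B h" using carrier_ab[of "\<sigma> b"] by auto
  have injD: "u = \<one>\<^bsub>G\<^esub>" if "\<sigma> u = \<one>\<^bsub>G\<^esub>" "u \<in> carrier G" for u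
    using that bij \<sigma>.hom_one inj_onD[OF bij_betw_imp_inj_on[OF bij], of u "\<one>\<^bsub>G\<^esub>"] by simp
  \<comment> \<open>Injectivity preserves a^(2q) \<noteq> 1, which rules out exponents of equal
    parity.\<close>
  have "\<sigma> a [^]\<^bsub>G\<^esub> (2 * q) \<noteq> \<one>\<^bsub>G\<^esub>"
    using injD[of "A (2 * q)"] a_pow_neq_one by (auto simp: \<sigma>.hom_int_pow)
  then have ij: "even i \<longleftrightarrow> odd j"
    using order_same_parity[of i j 0] unfolding x ab_eq_N by blast
  have "\<sigma> b [^]\<^bsub>G\<^esub> (2 * q) \<noteq> \<one>\<^bsub>G\<^esub>"
    using injD[of "B (2 * q)"] b_pow_neq_one by (auto simp: \<sigma>.hom_int_pow)
  then have fh: "even f \<longleftrightarrow> odd h"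
    using order_same_parity[of f h 0] unfolding y ab_eq_N by blast
  \<comment> \<open>For (c, d) = (1, 0) this says that i and f are not both even, for (0, 1) the
    same of j and h. Otherwise the parity homomorphism would vanish on the whole image of
    \<sigma>.\<close>
  have proper: "\<not> (even (i * c + j * d) \<and> even (f * c + h * d))"
    if cd: "c \<in> {0, 1}" "d \<in> {0, 1}" "c + d = 1" for c d :: int
  proof
    assume even: "even (i * c + j * d) \<and> even (f * c + h * d)"
    obtain \<chi> where \<chi>: "\<chi> \<in> hom G (integer_mod_group 2)"
      "\<And>x y. \<chi> (A x \<otimes>\<^bsub>G\<^esub> B y) = (x * c + y * d) mod 2"
      using parity_hom[OF cd(1,2)] by blast
    interpret \<chi>\<sigma>: group_hom G "integer_mod_group 2" "\<chi> \<circ> \<sigma>"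
    proof (intro group_hom.intro group_hom_axioms.intro is_group group_integer_mod_group homI)
      show "(\<chi> \<circ> \<sigma>) g \<in> carrier (integer_mod_group 2)" if "g \<in> carrier G" for g
        using that hom_in_carrier[OF \<chi>(1)] by simp
      show "(\<chi> \<circ> \<sigma>) (g \<otimes>\<^bsub>G\<^esub> g') =
          (\<chi> \<circ> \<sigma>) g \<otimes>\<^bsub>integer_mod_group 2\<^esub> (\<chi> \<circ> \<sigma>) g'"
        if "g \<in> carrier G" "g' \<in> carrier G" for g g'
        using that hom_mult[OF \<chi>(1)] by simp
    qed
    have "a \<in> kernel G (integer_mod_group 2) (\<chi> \<circ> \<sigma>)" "b \<in> kernel G (integer_mod_group 2) (\<chi> \<circ> \<sigma>)"
      using even by (simp_all add: kernel_def x y \<chi>(2))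
    then have trivial: "\<chi> (\<sigma> g) = 0" if "g \<in> carrier G" for g
      using subgroup_full[OF \<chi>\<sigma>.subgroup_kernel _ _ that] by (simp add: kernel_def)
    \<comment> \<open>The element ab serves both choices of (c, d), since its parity value is c + d
      = 1.\<close>
    have "A 1 \<otimes>\<^bsub>G\<^esub> B 1 \<in> \<sigma> ` carrier G"
      using bij by (simp add: bij_betw_def)
    then have "\<chi> (A 1 \<otimes>\<^bsub>G\<^esub> B 1) = 0"
      using trivial by fastforce
    then show False using \<chi>(2)[of 1 1] cd(3) by simp
  qed
  have parity: "exponent_parity i j f h"
    using ij fh proper[of 1 0] proper[of 0 1] unfolding exponent_parity_def by auto
  have "\<sigma> z = z"
    using images(1)[OF parity] unfolding other_relations_def
    by (simp add: z_def \<sigma>.hom_int_pow x y)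
  \<comment> \<open>As z is fixed, \<sigma> carries the commutator relation to the relation for the
    images with the same z, which \<open>images\<close> turns into condition (ii).\<close>
  then have "\<sigma> b \<otimes>\<^bsub>G\<^esub> \<sigma> a = \<sigma> a \<otimes>\<^bsub>G\<^esub> \<sigma> b \<otimes>\<^bsub>G\<^esub> \<sigma> a [^]\<^bsub>G\<^esub> (2::int) \<otimes>\<^bsub>G\<^esub> \<sigma> b [^]\<^bsub>G\<^esub> (-2::int)
      \<otimes>\<^bsub>G\<^esub> Z (int k)"
    using arg_cong[OF commutator, of \<sigma>] by (simp add: \<sigma>.hom_int_pow flip: z_def)
  then have "Z (int l * ((i + j - f - h) div 2)) = \<one>\<^bsub>G\<^esub>"
    using images(2)[OF parity] by (simp add: x y)
  with parity x y show ?thesis by blast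
qed

end

theorem corollary2p4:
  fixes e k l :: nat
  defines "G \<equiv> G2 e k l" and "a \<equiv> G2_a e k l" and "b \<equiv> G2_b e k l"
  assumes "e \<ge> 2" and "k \<in> {0, 1}" and "l \<in> {0, 1}" and "e = 2 \<Longrightarrow> k = 0 \<and> l = 0"
  shows "(\<forall>i j f h. aut_exponents l i j f h \<longrightarrow>
            (\<exists>!\<sigma>. \<sigma> \<in> auto G \<and>
               \<sigma> a = a [^]\<^bsub>G\<^esub> i \<otimes>\<^bsub>G\<^esub> b [^]\<^bsub>G\<^esub> j \<and>
               \<sigma> b = a [^]\<^bsub>G\<^esub> f \<otimes>\<^bsub>G\<^esub> b [^]\<^bsub>G\<^esub> h)) \<and>
         (\<forall>\<sigma>\<in>auto G. \<exists>i j f h. aut_exponents l i j f h \<and>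
               \<sigma> a = a [^]\<^bsub>G\<^esub> i \<otimes>\<^bsub>G\<^esub> b [^]\<^bsub>G\<^esub> j \<and>
               \<sigma> b = a [^]\<^bsub>G\<^esub> f \<otimes>\<^bsub>G\<^esub> b [^]\<^bsub>G\<^esub> h)"
proof -
  interpret P: G2_presentation e k l
    using assms(4,7) by unfold_locales
  have unique: "\<sigma> = \<tau>"
    if \<sigma>: "\<sigma> \<in> auto G" and \<tau>: "\<tau> \<in> auto G" and eq: "\<sigma> a = \<tau> a" "\<sigma> b = \<tau> b" for \<sigma> \<tau>
  \<comment> \<open>Members of \<open>auto G\<close> have a fixed default value off the carrier, so
    agreement on the carrier gives equality of functions.\<close>
  proof (rule extensionalityI)
    show "\<sigma> \<in> extensional (carrier G)" "\<tau> \<in> extensional (carrier G)"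
      using \<sigma> \<tau> by (simp_all add: auto_def Bij_def)
    show "\<sigma> g = \<tau> g" if "g \<in> carrier G" for g
      using P.hom_eqI[of \<sigma> \<tau> g] \<sigma> \<tau> eq that by (simp add: auto_def G_def a_def b_def)
  qed
  show ?thesis
  proof (intro conjI allI impI ballI)
    fix i j f h
    assume "aut_exponents l i j f h"
    then have E: "P.exponent_parity i j f h \<and>
        P.Z (int l * ((i + j - f - h) div 2)) = \<one>\<^bsub>G2 e k l\<^esub>"
      by (rule P.aut_exponents_iff[OF assms(6), THEN iffD1])
    obtain \<sigma> where "\<sigma> \<in> auto G" "\<sigma> a = a [^]\<^bsub>G\<^esub> i \<otimes>\<^bsub>G\<^esub> b [^]\<^bsub>G\<^esub> j"
        "\<sigma> b = a [^]\<^bsub>G\<^esub> f \<otimes>\<^bsub>G\<^esub> b [^]\<^bsub>G\<^esub> h"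
      unfolding G_def a_def b_def
      using P.aut_exists[OF E[THEN conjunct1] E[THEN conjunct2]] by (elim bexE conjE)
    then show "\<exists>!\<sigma>. \<sigma> \<in> auto G \<and> \<sigma> a = a [^]\<^bsub>G\<^esub> i \<otimes>\<^bsub>G\<^esub> b [^]\<^bsub>G\<^esub> j \<and>
        \<sigma> b = a [^]\<^bsub>G\<^esub> f \<otimes>\<^bsub>G\<^esub> b [^]\<^bsub>G\<^esub> h"
      by (intro ex1I[of _ \<sigma>]) (simp_all add: unique)
  next
    fix \<sigma> assume "\<sigma> \<in> auto G"
    then have "\<sigma> \<in> auto (G2 e k l)" by (simp add: G_def)
    from P.aut_form[OF this]
    show "\<exists>i j f h. aut_exponents l i j f h \<and> \<sigma> a = a [^]\<^bsub>G\<^esub> i \<otimes>\<^bsub>G\<^esub> b [^]\<^bsub>G\<^esub> j \<and>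
        \<sigma> b = a [^]\<^bsub>G\<^esub> f \<otimes>\<^bsub>G\<^esub> b [^]\<^bsub>G\<^esub> h"
      by (simp only: P.aut_exponents_iff[OF assms(6)] G_def a_def b_def conj_assoc)
  qed
qed

end
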